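(* Let $F$ be a complete multipartite graph with $\ell$ vertices. The following hold. (i) For every positive integer $n$ and every real $\alpha\ge 1$, there exists an $n$-vertex complete multipartite graph $G$ such that $\lambda_\alpha^{\mathrm{ind}}(F,G)=\operatorname{spec}_\alpha^{\mathrm{ind}}(F,n)$. (ii) For every positive integer $n$ and every real $\alpha\ge 1$, if an $n$-vertex complete multipartite graph $G$ satisfies $\lambda_\alpha^{\mathrm{ind}}(F,G)=\operatorname{spec}_\alpha^{\mathrm{ind}}(F,n)$, then there exists a vector $\mathbf{x}\in\operatorname{OPT}_{\alpha,F}(G)$ whose entries are identical on each part of $G$. (iii) For every fixed real $\alpha\ge 1$, as $n\to\infty$, $\operatorname{spec}_\alpha^{\mathrm{ind}}(F,n)=\left(i(F)+o(1)\right)n^{\ell(1-1/\alpha)}$.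
   Context: Graphs are finite and simple. A complete multipartite graph is a graph whose vertex set is partitioned into nonempty independent sets (its parts; one part is allowed) such that any two vertices in different parts are adjacent. Let $F$ be an $\ell$-vertex graph and $G$ an $n$-vertex graph; vectors in $\mathbb{R}^n$ are indexed by $V(G)$. Put $H_F(G)=\{S\subseteq V(G): G[S]\cong F\}$, where $G[S]$ is the induced subgraph, and $P_{F,G}(\mathbf{x})=\ell!\sum_{e\in H_F(G)}\prod_{i\in e}x_i$. For real $\alpha\ge1$ define $\lambda_\alpha^{\mathrm{ind}}(F,G)=\max\{P_{F,G}(\mathbf{x}):\mathbf{x}\in\mathbb{R}^n,\ \sum_i|x_i|^\alpha=1\}$, $\Delta_\alpha^{n-1}=\{\mathbf{x}\in\mathbb{R}_{\ge0}^n:\sum_i x_i^\alpha=1\}$, $\operatorname{OPT}_{\alpha,F}(G)=\{\mathbf{x}\in\Delta_\alpha^{n-1}:P_{F,G}(\mathbf{x})=\lambda_\alpha^{\mathrm{ind}}(F,G)\}$, and $\operatorname{spec}_\alpha^{\mathrm{ind}}(F,n)=\max\{\lambda_\alpha^{\mathrm{ind}}(F,G): G\text{ an }n\text{-vertex graph}\}$. Let $I(F,G)=|H_F(G)|$ be the number of vertex subsets of $G$ inducing a copy of $F$, $I(F,n)=\max\{I(F,G): G\text{ an }n\text{-vertex graph}\}$, and let $i(F)=\lim_{n\to\infty}I(F,n)/\binom{n}{\ell}$ be the inducibility of $F$ (the ratio is non-increasing in $n$, so the limit exists). *)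

theory Defs
  imports Complex_Main "HOL-Library.Disjoint_Sets" "HOL-Library.Landau_Symbols"
begin

type_synonym 'v ugraph = "'v set \<times> 'v set set"

abbreviation verts :: "'v ugraph \<Rightarrow> 'v set" where "verts G \<equiv> fst G"
abbreviation edges :: "'v ugraph \<Rightarrow> 'v set set" where "edges G \<equiv> snd G"

definition simple_graph :: "'v ugraph \<Rightarrow> bool" where
  "simple_graph G \<longleftrightarrow> finite (verts G) \<and> (\<forall>e\<in>edges G. e \<subseteq> verts G \<and> card e = 2)"

definition induced :: "'v ugraph \<Rightarrow> 'v set \<Rightarrow> 'v ugraph" where
  "induced G S = (S, {e \<in> edges G. e \<subseteq> S})"

definition isomorphic :: "'v ugraph \<Rightarrow> 'w ugraph \<Rightarrow> bool" where
  "isomorphic G H \<longleftrightarrow> (\<exists>f. bij_betw f (verts G) (verts H) \<and>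
     (\<forall>u\<in>verts G. \<forall>v\<in>verts G. {u, v} \<in> edges G \<longleftrightarrow> {f u, f v} \<in> edges H))"

text \<open>\<^term>\<open>partition_on\<close> already requires the parts to be nonempty.\<close>

definition multipartition :: "'v ugraph \<Rightarrow> 'v set set \<Rightarrow> bool" where
  "multipartition G P \<longleftrightarrow> partition_on (verts G) P \<and>
     (\<forall>A\<in>P. \<forall>u\<in>A. \<forall>v\<in>A. {u, v} \<notin> edges G) \<and>
     (\<forall>A\<in>P. \<forall>B\<in>P. A \<noteq> B \<longrightarrow> (\<forall>u\<in>A. \<forall>v\<in>B. {u, v} \<in> edges G))"

definition complete_multipartite :: "'v ugraph \<Rightarrow> bool" where
  "complete_multipartite G \<longleftrightarrow> simple_graph G \<and> (\<exists>P. multipartition G P)"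

definition copies :: "'a ugraph \<Rightarrow> 'v ugraph \<Rightarrow> 'v set set" where
  "copies F G = {S. S \<subseteq> verts G \<and> isomorphic (induced G S) F}"

text \<open>A real vector indexed by the vertices of \<open>G\<close> is a function on the whole vertex type, of which
  only the values on \<^term>\<open>verts G\<close> matter.\<close>

definition ind_poly :: "'a ugraph \<Rightarrow> 'v ugraph \<Rightarrow> ('v \<Rightarrow> real) \<Rightarrow> real" where
  "ind_poly F G x = fact (card (verts F)) * (\<Sum>e\<in>copies F G. \<Prod>i\<in>e. x i)"

text \<open>\<^const>\<open>Greatest\<close> is the maximum of a set of reals that may be infinite (\<^const>\<open>Max\<close> is only
  meaningful on finite sets). Here it exists, by compactness, whenever \<open>G\<close> is a finite graph with
  at least one vertex and \<open>\<alpha> \<ge> 1\<close>. The convention \<open>0 powr \<alpha> = 0\<close> is the correct value for such \<open>\<alpha>\<close>.\<close>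

definition lam_ind :: "real \<Rightarrow> 'a ugraph \<Rightarrow> 'v ugraph \<Rightarrow> real" where
  "lam_ind \<alpha> F G =
     (GREATEST y. y \<in> {ind_poly F G x | x. (\<Sum>i\<in>verts G. \<bar>x i\<bar> powr \<alpha>) = 1})"

definition nonneg_sphere :: "real \<Rightarrow> 'v ugraph \<Rightarrow> ('v \<Rightarrow> real) set" where
  "nonneg_sphere \<alpha> G =
     {x. (\<forall>i\<in>verts G. x i \<ge> 0) \<and> (\<Sum>i\<in>verts G. x i powr \<alpha>) = 1}"

definition OPT :: "real \<Rightarrow> 'a ugraph \<Rightarrow> 'v ugraph \<Rightarrow> ('v \<Rightarrow> real) set" where
  "OPT \<alpha> F G = {x \<in> nonneg_sphere \<alpha> G. ind_poly F G x = lam_ind \<alpha> F G}"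

text \<open>Every \<open>n\<close>-vertex graph is isomorphic to one on \<open>{..<n}\<close>, so the maxima over all \<open>n\<close>-vertex
  graphs may be taken over this finite set of graphs.\<close>

definition graphs_on :: "nat \<Rightarrow> nat ugraph set" where
  "graphs_on n = {G. simple_graph G \<and> verts G = {..<n}}"

definition spec_ind :: "real \<Rightarrow> 'a ugraph \<Rightarrow> nat \<Rightarrow> real" where
  "spec_ind \<alpha> F n = Max (lam_ind \<alpha> F ` graphs_on n)"

definition max_copies :: "'a ugraph \<Rightarrow> nat \<Rightarrow> nat" where
  "max_copies F n = Max ((\<lambda>G. card (copies F G)) ` graphs_on n)"

definition inducibility :: "'a ugraph \<Rightarrow> real" where
  "inducibility F = lim (\<lambda>n. real (max_copies F n) / real (n choose card (verts F)))"

end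

theory Submission
  imports Defs "HOL-Analysis.Analysis"
begin

text \<open>
  Three ideas carry the proof, one for each claim.

  Claim (i) is Zykov symmetrisation. Fix a vector \<open>x\<close> and two nonadjacent vertices \<open>u\<close>, \<open>v\<close> of \<open>G\<close>.
  As a polynomial in \<open>x u\<close> and \<open>x v\<close> the value of \<open>G\<close> is \<open>a + b x u + c x v + d x u x v\<close>. A complete
  multipartite \<open>F\<close> cannot distinguish two of its nonadjacent vertices, so an induced copy of \<open>F\<close>
  through both \<open>u\<close> and \<open>v\<close> survives when \<open>v\<close> is replaced by a clone of \<open>u\<close>; the clone therefore has
  value at least \<open>a + b (x u + x v) + d x u x v\<close>. Comparing with the clone in the other direction
  shows that, for positive \<open>x\<close>, a graph of maximal value satisfies \<open>b = c\<close> and stays maximal under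
  cloning (\<open>maximal_at_clone\<close>). Cloning towards the vertex with more twins creates new twin pairs,
  so a maximal graph with the most twin pairs has only twins among its nonadjacent pairs, that is,
  it is complete multipartite (\<open>multipartite_maximiser_positive\<close>). Vectors with zero entries are
  approximated by positive ones; there are only finitely many graphs on \<open>n\<close> labelled vertices
  (\<open>multipartite_dominates\<close>).

  Claim (ii) is an averaging argument. Two vertices of one part are nonadjacent twins, so in the expansion above \<open>b = c\<close> and all coefficients are
  nonnegative. Replacing both entries by their power mean of exponent \<open>\<alpha>\<close> preserves the constraint,
  does not decrease the value, and reduces the spread of the entries
  (\<open>ind_poly_average_twins\<close>). Among all optimal vectors, which form a compact set, one that minimises
  the sum of the squares of \<open>x i powr \<alpha>\<close> cannot be improved in this way, and is constant on each part
  (\<open>exists_optimum_constant_on_parts\<close>).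

  Claim (iii) compares everything with the densities \<open>l! * max_copies F n / n ^ l\<close>. Such a density is
  the value of an extremal graph at the constant vector \<open>1 / n\<close>. Conversely, blowing up vertex \<open>i\<close> of
  a graph \<open>G\<close> into about \<open>x i * N\<close> vertices turns its value at a vector \<open>x\<close> of the standard simplex
  into a lower bound for the density at \<open>N\<close>, up to an error that vanishes as \<open>N\<close> grows
  (\<open>eventually_copy_density_gt\<close>). Hence the densities converge to their supremum, the limit is the
  inducibility, and no value on the simplex exceeds it (\<open>ind_poly_le_inducibility\<close>). For general
  \<open>\<alpha>\<close> the constant vector gives the lower bound (\<open>spec_ind_ge\<close>); the upper bound (\<open>lam_ind_le\<close>)
  rescales an optimal vector to the simplex, its sum being at most \<open>n powr (1 - 1 / \<alpha>)\<close> by the power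
  mean inequality.
\<close>

section \<open>Pullbacks of graphs and the transfer of induced copies\<close>

text \<open>Both cloning (a vertex map that sends one vertex to another) and blowing up (a map that is
  constant on each blown-up vertex) are pullbacks, so both inherit the same description of their
  induced copies. A fibre of the map is always independent, since the base graph has no loops.\<close>

definition pullback :: "('w \<Rightarrow> 'v) \<Rightarrow> 'w set \<Rightarrow> 'v ugraph \<Rightarrow> 'w ugraph" where
  "pullback \<phi> W G = (W, {{a, b} | a b. a \<in> W \<and> b \<in> W \<and> {\<phi> a, \<phi> b} \<in> edges G})"

lemma verts_pullback [simp]: "verts (pullback \<phi> W G) = W"
  by (simp add: pullback_def)

lemma edge_pullback_iff:
  assumes "a \<in> W" "b \<in> W"
  shows "{a, b} \<in> edges (pullback \<phi> W G) \<longleftrightarrow> {\<phi> a, \<phi> b} \<in> edges G"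
  using assms by (auto simp: pullback_def doubleton_eq_iff insert_commute)

lemma no_loops: "simple_graph G \<Longrightarrow> {u, u} \<notin> edges G"
  by (force simp: simple_graph_def)

lemma edge_in_verts: "simple_graph G \<Longrightarrow> {u, v} \<in> edges G \<Longrightarrow> u \<in> verts G \<and> v \<in> verts G"
  by (force simp: simple_graph_def)

lemma simple_graph_pullback:
  assumes "simple_graph G" "finite W"
  shows "simple_graph (pullback \<phi> W G)"
proof -
  have "a \<noteq> b" if "{\<phi> a, \<phi> b} \<in> edges G" for a b
    using that no_loops[OF assms(1)] by auto
  then show ?thesis
    using assms(2) by (auto simp: simple_graph_def pullback_def)
qed

lemma copies_iff:
  "S \<in> copies F G \<longleftrightarrow> S \<subseteq> verts G \<and> (\<exists>g. bij_betw g S (verts F) \<and>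
     (\<forall>a\<in>S. \<forall>b\<in>S. {a, b} \<in> edges G \<longleftrightarrow> {g a, g b} \<in> edges F))"
  by (auto simp: copies_def isomorphic_def induced_def)

text \<open>Every later comparison of copies in two graphs (twins, clones, blow-ups) comes from a vertex
  map that preserves adjacency on the set in question only, not on the whole graph.\<close>

lemma copies_transfer:
  assumes S: "S \<subseteq> verts H" and inj: "inj_on f S" and im: "f ` S \<subseteq> verts G"
    and adj: "\<And>a b. a \<in> S \<Longrightarrow> b \<in> S \<Longrightarrow> {a, b} \<in> edges H \<longleftrightarrow> {f a, f b} \<in> edges G"
  shows "S \<in> copies F H \<longleftrightarrow> f ` S \<in> copies F G"
proof
  assume "S \<in> copies F H"
  then obtain g where g: "bij_betw g S (verts F)"
    "\<And>a b. a \<in> S \<Longrightarrow> b \<in> S \<Longrightarrow> {a, b} \<in> edges H \<longleftrightarrow> {g a, g b} \<in> edges F"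
    by (auto simp: copies_iff)
  let ?h = "g \<circ> inv_into S f"
  have "bij_betw ?h (f ` S) (verts F)"
    using bij_betw_trans[OF bij_betw_inv_into[OF inj_on_imp_bij_betw[OF inj]] g(1)] .
  moreover have "\<forall>a\<in>f ` S. \<forall>b\<in>f ` S. {a, b} \<in> edges G \<longleftrightarrow> {?h a, ?h b} \<in> edges F"
    using inj g(2) adj by auto
  ultimately show "f ` S \<in> copies F G"
    using im unfolding copies_iff by blast
next
  assume "f ` S \<in> copies F G"
  then obtain g where g: "bij_betw g (f ` S) (verts F)"
    "\<And>a b. a \<in> S \<Longrightarrow> b \<in> S \<Longrightarrow> {f a, f b} \<in> edges G \<longleftrightarrow> {g (f a), g (f b)} \<in> edges F"
    by (auto simp: copies_iff)
  have "bij_betw (g \<circ> f) S (verts F)"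
    using bij_betw_trans[OF inj_on_imp_bij_betw[OF inj] g(1)] .
  then show "S \<in> copies F H"
    using S g(2) adj unfolding copies_iff by (metis comp_apply)
qed

lemma copies_pullback_iff:
  assumes "S \<subseteq> W" "inj_on \<phi> S" "\<phi> ` S \<subseteq> verts G"
  shows "S \<in> copies F (pullback \<phi> W G) \<longleftrightarrow> \<phi> ` S \<in> copies F G"
proof (rule copies_transfer)
  show "{a, b} \<in> edges (pullback \<phi> W G) \<longleftrightarrow> {\<phi> a, \<phi> b} \<in> edges G" if "a \<in> S" "b \<in> S" for a b
    using that assms(1) by (intro edge_pullback_iff) auto
qed (use assms in auto)

lemma copies_subset: "e \<in> copies F G \<Longrightarrow> e \<subseteq> verts G"
  by (simp add: copies_def)

lemma finite_copies: "simple_graph G \<Longrightarrow> finite (copies F G)"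
  by (rule finite_subset[of _ "Pow (verts G)"]) (auto simp: copies_def simple_graph_def)

lemma finite_copy: "simple_graph G \<Longrightarrow> e \<in> copies F G \<Longrightarrow> finite e"
  by (meson copies_subset finite_subset simple_graph_def)

lemma card_copy: "e \<in> copies F G \<Longrightarrow> card e = card (verts F)"
  by (auto simp: copies_iff dest: bij_betw_same_card)

text \<open>For a simple graph this is equivalent to being complete multipartite, and it is the form in
  which the hypothesis on \<open>F\<close> is used and in which extremal graphs are found.\<close>

definition nonadj_trans :: "'v ugraph \<Rightarrow> bool" where
  "nonadj_trans G \<longleftrightarrow> (\<forall>a\<in>verts G. \<forall>b\<in>verts G. \<forall>c\<in>verts G.
     {a, b} \<notin> edges G \<longrightarrow> {b, c} \<notin> edges G \<longrightarrow> {a, c} \<notin> edges G)"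

lemma multipartition_adj_iff:
  assumes "multipartition G P" "A \<in> P" "B \<in> P" "u \<in> A" "v \<in> B"
  shows "{u, v} \<in> edges G \<longleftrightarrow> A \<noteq> B"
  using assms unfolding multipartition_def by blast

lemma multipartition_imp_nonadj_trans:
  assumes "multipartition G P"
  shows "nonadj_trans G"
proof -
  have V: "verts G = \<Union>P"
    using assms by (simp add: multipartition_def partition_on_def)
  have "{a, c} \<notin> edges G"
    if abc: "a \<in> verts G" "b \<in> verts G" "c \<in> verts G" "{a, b} \<notin> edges G" "{b, c} \<notin> edges G" for a b c
  proof -
    obtain A B C where ABC: "A \<in> P" "a \<in> A" "B \<in> P" "b \<in> B" "C \<in> P" "c \<in> C"
      using abc(1-3) unfolding V by blast
    have "A = B" "B = C"
      using multipartition_adj_iff[OF assms ABC(1,3,2,4)] multipartition_adj_iff[OF assms ABC(3,5,4,6)] abc(4,5)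
      by blast+
    then show ?thesis using multipartition_adj_iff[OF assms ABC(1,5,2,6)] by blast
  qed
  then show ?thesis unfolding nonadj_trans_def by blast
qed

text \<open>The parts are the classes of nonadjacency, which is reflexive because there are no loops.\<close>

lemma complete_multipartite_if_nonadj_trans:
  assumes simple: "simple_graph G" and trans: "nonadj_trans G"
  shows "complete_multipartite G"
proof -
  define r where "r = {(a, b). a \<in> verts G \<and> b \<in> verts G \<and> {a, b} \<notin> edges G}"
  have eq: "equiv (verts G) r"
  proof (rule equivI)
    show "refl_on (verts G) r"
      using no_loops[OF simple] by (auto simp: refl_on_def r_def)
    show "sym r" by (auto simp: sym_def r_def insert_commute)
    show "trans r" using trans unfolding trans_def r_def nonadj_trans_def by blast
  qed (auto simp: r_def)
  have "multipartition G (verts G // r)"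
    unfolding multipartition_def
  proof (intro conjI ballI impI)
    show "partition_on (verts G) (verts G // r)"
      using eq by (rule partition_on_quotient)
  next
    fix A u v assume "A \<in> verts G // r" "u \<in> A" "v \<in> A"
    then have "(u, v) \<in> r" using eq by (meson quotient_eq_iff)
    then show "{u, v} \<notin> edges G" by (simp add: r_def)
  next
    fix A B u v assume *: "A \<in> verts G // r" "B \<in> verts G // r" "A \<noteq> B" "u \<in> A" "v \<in> B"
    then have "(u, v) \<notin> r" using eq by (meson quotient_eq_iff)
    moreover have "u \<in> verts G" "v \<in> verts G"
      using * eq in_quotient_imp_subset by blast+
    ultimately show "{u, v} \<in> edges G" by (simp add: r_def)
  qed
  then show ?thesis using simple by (auto simp: complete_multipartite_def)
qed

section \<open>Expanding the polynomial in two variables\<close>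

text \<open>The members of \<open>K\<close> that meet \<open>D\<close> exactly in \<open>X\<close> (for \<open>X \<subseteq> D\<close>), with \<open>X\<close> removed.\<close>

definition link :: "'v set set \<Rightarrow> 'v set \<Rightarrow> 'v set \<Rightarrow> 'v set set" where
  "link K D X = {T. T \<inter> D = {} \<and> T \<union> X \<in> K}"


lemma sum_prod_expand:
  fixes x :: "'v \<Rightarrow> real"
  assumes K: "finite K" "\<And>e. e \<in> K \<Longrightarrow> finite e" and D: "finite D"
  shows "(\<Sum>e\<in>K. \<Prod>i\<in>e. x i) = (\<Sum>X\<in>Pow D. (\<Prod>i\<in>X. x i) * (\<Sum>T\<in>link K D X. \<Prod>i\<in>T. x i))"
proof -
  have "(\<Sum>e\<in>K. \<Prod>i\<in>e. x i) = (\<Sum>X\<in>Pow D. \<Sum>e\<in>{e\<in>K. e \<inter> D = X}. \<Prod>i\<in>e. x i)"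
    by (rule sum.group[symmetric]) (use K D in auto)
  also have "\<dots> = (\<Sum>X\<in>Pow D. (\<Prod>i\<in>X. x i) * (\<Sum>T\<in>link K D X. \<Prod>i\<in>T. x i))"
  proof (rule sum.cong[OF refl])
    fix X assume X: "X \<in> Pow D"
    have "(\<Sum>e\<in>{e\<in>K. e \<inter> D = X}. \<Prod>i\<in>e. x i) = (\<Sum>T\<in>link K D X. \<Prod>i\<in>T \<union> X. x i)"
    proof (rule sum.reindex_bij_witness[where i = "\<lambda>T. T \<union> X" and j = "\<lambda>e. e - D"])
      fix e assume e: "e \<in> {e\<in>K. e \<inter> D = X}"
      then show *: "e - D \<union> X = e" by auto
      show "e - D \<in> link K D X" using e * by (auto simp: link_def)
      show "(\<Prod>i\<in>e - D \<union> X. x i) = (\<Prod>i\<in>e. x i)" by (simp add: *)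
    qed (use X in \<open>auto simp: link_def\<close>)
    also have "\<dots> = (\<Sum>T\<in>link K D X. (\<Prod>i\<in>X. x i) * (\<Prod>i\<in>T. x i))"
    proof (rule sum.cong[OF refl])
      fix T assume T: "T \<in> link K D X"
      then have "T \<union> X \<in> K" "T \<inter> X = {}" using X by (auto simp: link_def)
      moreover from this have "finite T" "finite X" using K(2) by blast+
      ultimately show "(\<Prod>i\<in>T \<union> X. x i) = (\<Prod>i\<in>X. x i) * (\<Prod>i\<in>T. x i)"
        by (simp add: prod.union_disjoint mult.commute)
    qed
    finally show "(\<Sum>e\<in>{e\<in>K. e \<inter> D = X}. \<Prod>i\<in>e. x i) =
        (\<Prod>i\<in>X. x i) * (\<Sum>T\<in>link K D X. \<Prod>i\<in>T. x i)"
      by (simp add: sum_distrib_left)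
  qed
  finally show ?thesis .
qed

text \<open>The coefficient of the monomial \<open>\<Prod>i\<in>X. x i\<close> when the sum over all copies is read as a
  polynomial in the variables indexed by \<open>D\<close>.\<close>

definition coef :: "'a ugraph \<Rightarrow> 'v ugraph \<Rightarrow> 'v set \<Rightarrow> 'v set \<Rightarrow> ('v \<Rightarrow> real) \<Rightarrow> real" where
  "coef F G D X x = (\<Sum>T\<in>link (copies F G) D X. \<Prod>i\<in>T. x i)"

lemma link_copiesD: 
  assumes "T \<in> link (copies F G) D X"
  shows "T \<subseteq> verts G" "T \<inter> D = {}"
  using assms copies_subset by (fastforce simp: link_def)+

lemma finite_link_copies: "simple_graph G \<Longrightarrow> finite (link (copies F G) D X)"
  by (rule finite_subset[of _ "Pow (verts G)"]) (auto dest: link_copiesD simp: simple_graph_def)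

lemma coef_nonneg:
  assumes "\<And>i. i \<in> verts G \<Longrightarrow> x i \<ge> 0"
  shows "coef F G D X x \<ge> 0"
  unfolding coef_def using assms by (intro sum_nonneg prod_nonneg) (auto dest: link_copiesD)

lemma coef_cong:
  assumes "\<And>i. i \<notin> D \<Longrightarrow> x i = y i"
  shows "coef F G D X x = coef F G D X y"
  unfolding coef_def using assms by (intro sum.cong prod.cong) (auto dest: link_copiesD)

lemma coef_mono:
  assumes "simple_graph H" "\<And>i. i \<in> verts H \<Longrightarrow> x i \<ge> 0"
    "link (copies F G) D X \<subseteq> link (copies F H) D Y"
  shows "coef F G D X x \<le> coef F H D Y x"
  unfolding coef_def using assms
  by (intro sum_mono2 finite_link_copies prod_nonneg) (auto dest: link_copiesD)

lemma ind_poly_two_variables: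
  assumes "simple_graph G" "u \<noteq> v"
  shows "ind_poly F G x = fact (card (verts F)) *
    (coef F G {u, v} {} x + x u * coef F G {u, v} {u} x + x v * coef F G {u, v} {v} x
      + x u * x v * coef F G {u, v} {u, v} x)"
proof -
  have "Pow {u, v} = {{}, {u}, {v}, {u, v}}" by auto
  moreover have "(\<Sum>e\<in>copies F G. \<Prod>i\<in>e. x i) =
      (\<Sum>X\<in>Pow {u, v}. (\<Prod>i\<in>X. x i) * coef F G {u, v} X x)"
    unfolding coef_def using assms
    by (intro sum_prod_expand) (auto simp: finite_copies finite_copy)
  ultimately show ?thesis
    using assms(2) by (simp add: ind_poly_def)
qed

section \<open>Maximisers exist\<close>

text \<open>Optimal vectors may have zero entries, so convexity is needed on the closed half-line.\<close>

lemma powr_convex_nonneg: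
  assumes "\<alpha> \<ge> 1"
  shows "convex_on {0..} (\<lambda>x :: real. x powr \<alpha>)"
proof (rule convex_onI)
  fix t x y :: real
  assume t: "0 < t" "t < 1" and xy: "x \<in> {0..}" "y \<in> {0..}"
  have le: "s powr \<alpha> \<le> s" if "0 < s" "s < 1" for s :: real
    using powr_mono'[of 1 \<alpha> s] that assms by simp
  consider "x = 0" | "y = 0" | "x > 0" "y > 0" using xy by fastforce
  then have "((1 - t) * x + t * y) powr \<alpha> \<le> (1 - t) * x powr \<alpha> + t * y powr \<alpha>"
  proof cases
    case 3
    then show ?thesis using convex_onD[OF powr_convex[OF assms], of t x y] t by simp
  qed (use t xy le[of t] le[of "1 - t"] in \<open>auto simp: powr_mult intro!: mult_right_mono\<close>)
  then show "((1 - t) *\<^sub>R x + t *\<^sub>R y) powr \<alpha> \<le> (1 - t) * x powr \<alpha> + t * y powr \<alpha>"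
    by simp
qed auto

lemma power_mean_le:
  fixes x :: "'v \<Rightarrow> real"
  assumes V: "finite V" "V \<noteq> {}" and x: "\<And>i. i \<in> V \<Longrightarrow> x i \<ge> 0" and \<alpha>: "\<alpha> \<ge> 1"
  shows "(\<Sum>i\<in>V. x i) / card V \<le> ((\<Sum>i\<in>V. x i powr \<alpha>) / card V) powr (1 / \<alpha>)"
proof -
  define n where "n = real (card V)"
  have n: "n > 0" using V by (simp add: n_def card_gt_0_iff)
  have "((\<Sum>i\<in>V. x i) / n) powr \<alpha> = (\<Sum>i\<in>V. (1 / n) *\<^sub>R x i) powr \<alpha>"
    by (simp add: sum_divide_distrib)
  also have "\<dots> \<le> (\<Sum>i\<in>V. 1 / n * x i powr \<alpha>)"
    using convex_on_sum[OF V powr_convex_nonneg[OF \<alpha>], of "\<lambda>_. 1 / n" x] V x n by (simp add: n_def)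
  also have "\<dots> = (\<Sum>i\<in>V. x i powr \<alpha>) / n"
    by (simp add: sum_divide_distrib)
  finally have "(((\<Sum>i\<in>V. x i) / n) powr \<alpha>) powr (1 / \<alpha>) \<le> ((\<Sum>i\<in>V. x i powr \<alpha>) / n) powr (1 / \<alpha>)"
    using \<alpha> by (intro powr_mono2) auto
  moreover have "(((\<Sum>i\<in>V. x i) / n) powr \<alpha>) powr (1 / \<alpha>) = (\<Sum>i\<in>V. x i) / n"
    using \<alpha> n sum_nonneg[OF x, of V] by (simp add: powr_powr)
  ultimately show ?thesis by (simp add: n_def)
qed

text \<open>Vectors live on the whole vertex type; setting them to \<open>0\<close> outside \<open>V\<close> and bounding them by \<open>1\<close>,
  which the constraint forces anyway, gives a compact set by Tychonoff's theorem. The absolute value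
  makes the constraint continuous on the whole function space.\<close>

definition ext_sphere :: "real \<Rightarrow> 'v set \<Rightarrow> ('v \<Rightarrow> real) set" where
  "ext_sphere \<alpha> V = {x. (\<forall>i\<in>V. 0 \<le> x i \<and> x i \<le> 1) \<and> (\<forall>i. i \<notin> V \<longrightarrow> x i = 0) \<and>
     (\<Sum>i\<in>V. \<bar>x i\<bar> powr \<alpha>) = 1}"

lemma ext_sphere_subset: "ext_sphere \<alpha> (verts G) \<subseteq> nonneg_sphere \<alpha> G"
proof
  fix x assume x: "x \<in> ext_sphere \<alpha> (verts G)"
  then have "\<forall>i\<in>verts G. x i \<ge> 0"
    by (auto simp: ext_sphere_def split: if_splits)
  moreover from this have "(\<Sum>i\<in>verts G. \<bar>x i\<bar> powr \<alpha>) = (\<Sum>i\<in>verts G. x i powr \<alpha>)"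
    by (intro sum.cong) auto
  ultimately show "x \<in> nonneg_sphere \<alpha> G"
    using x by (simp add: ext_sphere_def nonneg_sphere_def)
qed

lemma continuous_on_abs_powr_coordinate:
  "\<alpha> > 0 \<Longrightarrow> continuous_on S (\<lambda>x. \<bar>x i\<bar> powr \<alpha> :: real)"
  by (intro continuous_on_powr' continuous_intros continuous_on_subset[OF continuous_on_product_coordinates]) auto

lemma compact_ext_sphere:
  fixes V :: "'v set"
  assumes "\<alpha> > 0"
  shows "compact (ext_sphere \<alpha> V)"
proof -
  define S :: "'v \<Rightarrow> real set" where "S = (\<lambda>i. if i \<in> V then {0..1} else {0})"
  have "compactin (product_topology (\<lambda>_. euclidean) UNIV) (PiE UNIV S)"
    unfolding compactin_PiE by (simp add: S_def)
  then have "compact (PiE UNIV S)"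
    by (simp add: euclidean_product_topology)
  moreover have "closed {x :: 'v \<Rightarrow> real. (\<Sum>i\<in>V. \<bar>x i\<bar> powr \<alpha>) = 1}"
    using assms by (intro closed_Collect_eq continuous_on_sum continuous_on_abs_powr_coordinate) auto
  ultimately have "compact (PiE UNIV S \<inter> {x. (\<Sum>i\<in>V. \<bar>x i\<bar> powr \<alpha>) = 1})"
    by (rule compact_Int_closed)
  also have "PiE UNIV S = {x. (\<forall>i\<in>V. 0 \<le> x i \<and> x i \<le> 1) \<and> (\<forall>i. i \<notin> V \<longrightarrow> x i = 0)}"
    unfolding S_def PiE_UNIV_domain Pi_iff by (auto split: if_splits)
  also have "\<dots> \<inter> {x. (\<Sum>i\<in>V. \<bar>x i\<bar> powr \<alpha>) = 1} = ext_sphere \<alpha> V"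
    unfolding ext_sphere_def by blast
  finally show ?thesis .
qed

lemma continuous_on_ind_poly: "continuous_on S (ind_poly F G)"
  unfolding ind_poly_def
  by (intro continuous_intros continuous_on_subset[OF continuous_on_product_coordinates]) auto

lemma ind_poly_cong:
  assumes "\<And>i. i \<in> verts G \<Longrightarrow> x i = y i"
  shows "ind_poly F G x = ind_poly F G y"
  unfolding ind_poly_def using assms copies_subset
  by (intro arg_cong2[where f = "(*)"] sum.cong prod.cong) blast+

lemma ind_poly_le_abs: "ind_poly F G x \<le> ind_poly F G (\<lambda>i. \<bar>x i\<bar>)"
  unfolding ind_poly_def
  by (intro mult_left_mono sum_mono) (auto simp: abs_prod[symmetric])

lemma ext_sphere_dominates:
  fixes y :: "'v \<Rightarrow> real"
  assumes G: "simple_graph G" and \<alpha>: "\<alpha> > 0" and y: "(\<Sum>i\<in>verts G. \<bar>y i\<bar> powr \<alpha>) = 1"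
  shows "\<exists>x\<in>ext_sphere \<alpha> (verts G). ind_poly F G y \<le> ind_poly F G x"
proof
  let ?x = "\<lambda>i. if i \<in> verts G then \<bar>y i\<bar> else 0"
  have "\<bar>y i\<bar> \<le> 1" if i: "i \<in> verts G" for i
  proof (rule ccontr)
    assume "\<not> \<bar>y i\<bar> \<le> 1"
    then have "1 < \<bar>y i\<bar> powr \<alpha>" using \<alpha> by (simp add: gr_one_powr)
    also have "\<dots> \<le> (\<Sum>i\<in>verts G. \<bar>y i\<bar> powr \<alpha>)"
      using G i by (intro member_le_sum) (auto simp: simple_graph_def)
    finally show False using y by simp
  qed
  then show "?x \<in> ext_sphere \<alpha> (verts G)"
    using y by (simp add: ext_sphere_def)
  have "ind_poly F G ?x = ind_poly F G (\<lambda>i. \<bar>y i\<bar>)"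
    by (rule ind_poly_cong) simp
  then show "ind_poly F G y \<le> ind_poly F G ?x"
    using ind_poly_le_abs[of F G y] by simp
qed

lemma uniform_sphere:
  assumes "simple_graph G" "verts G \<noteq> {}" "\<alpha> > 0"
  shows "(\<Sum>i\<in>verts G. \<bar>real (card (verts G)) powr (- 1 / \<alpha>)\<bar> powr \<alpha>) = 1"
proof -
  have n: "real (card (verts G)) > 0"
    using assms by (simp add: simple_graph_def card_gt_0_iff)
  have "\<bar>real (card (verts G)) powr (- 1 / \<alpha>)\<bar> powr \<alpha> = real (card (verts G)) powr (- 1)"
    using assms(3) by (simp add: powr_powr del: powr_neg_one)
  then show ?thesis using n by (simp add: powr_neg_one)
qed

lemma lam_ind_attained:
  assumes G: "simple_graph G" "verts G \<noteq> {}" and \<alpha>: "\<alpha> > 0"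
  shows "\<exists>x\<in>ext_sphere \<alpha> (verts G). ind_poly F G x = lam_ind \<alpha> F G"
    and "(\<Sum>i\<in>verts G. \<bar>y i\<bar> powr \<alpha>) = 1 \<Longrightarrow> ind_poly F G y \<le> lam_ind \<alpha> F G"
proof -
  have ne: "ext_sphere \<alpha> (verts G) \<noteq> {}"
    using ext_sphere_dominates[OF G(1) \<alpha> uniform_sphere[OF G \<alpha>]] by blast
  obtain x where x: "x \<in> ext_sphere \<alpha> (verts G)"
      "\<And>y. y \<in> ext_sphere \<alpha> (verts G) \<Longrightarrow> ind_poly F G y \<le> ind_poly F G x"
    using continuous_attains_sup[OF compact_ext_sphere[OF \<alpha>] ne continuous_on_ind_poly] by blast
  have le: "ind_poly F G y \<le> ind_poly F G x" if "(\<Sum>i\<in>verts G. \<bar>y i\<bar> powr \<alpha>) = 1" for y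
    using ext_sphere_dominates[OF G(1) \<alpha> that] x(2) order_trans by blast
  have "lam_ind \<alpha> F G = ind_poly F G x"
    unfolding lam_ind_def using x(1) le by (intro Greatest_equality) (auto simp: ext_sphere_def)
  then show "\<exists>x\<in>ext_sphere \<alpha> (verts G). ind_poly F G x = lam_ind \<alpha> F G"
    "(\<Sum>i\<in>verts G. \<bar>y i\<bar> powr \<alpha>) = 1 \<Longrightarrow> ind_poly F G y \<le> lam_ind \<alpha> F G"
    using x(1) le by auto
qed

section \<open>Averaging over the parts\<close>

text \<open>In a simple graph no vertex is its own neighbour, so twins in this sense are nonadjacent.\<close>

definition twins :: "'v ugraph \<Rightarrow> 'v \<Rightarrow> 'v \<Rightarrow> bool" where
  "twins G u v \<longleftrightarrow> (\<forall>b. {u, b} \<in> edges G \<longleftrightarrow> {v, b} \<in> edges G)"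

lemma twins_nonadjacent: "simple_graph G \<Longrightarrow> twins G u v \<Longrightarrow> {u, v} \<notin> edges G"
  using no_loops[of G v] by (simp add: twins_def)

lemma twins_if_same_part:
  assumes G: "simple_graph G" and mp: "multipartition G P" and A: "A \<in> P" "u \<in> A" "v \<in> A"
  shows "twins G u v"
proof -
  have V: "verts G = \<Union>P" using mp by (simp add: multipartition_def partition_on_def)
  have "{u, b} \<in> edges G \<longleftrightarrow> {v, b} \<in> edges G" for b
  proof (cases "b \<in> verts G")
    case True
    then obtain B where "B \<in> P" "b \<in> B" using V by blast
    then show ?thesis
      using multipartition_adj_iff[OF mp, of A B u b] multipartition_adj_iff[OF mp, of A B v b] A by simp
  next
    case False
    then show ?thesis using edge_in_verts[OF G] by blast
  qed
  then show ?thesis by (simp add: twins_def)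
qed

lemma link_twins:
  assumes G: "simple_graph G" and tw: "twins G u v" and V: "u \<in> verts G" "v \<in> verts G"
  shows "link (copies F G) {u, v} {u} \<subseteq> link (copies F G) {u, v} {v}"
proof
  fix T assume T: "T \<in> link (copies F G) {u, v} {u}"
  let ?f = "\<lambda>a. if a = u then v else a"
  have uv: "u \<notin> T" "v \<notin> T" and Tu: "insert u T \<in> copies F G"
    using T by (auto simp: link_def)
  have im: "?f ` insert u T = insert v T" using uv by auto
  have "insert u T \<in> copies F G \<longleftrightarrow> ?f ` insert u T \<in> copies F G"
  proof (rule copies_transfer)
    show "insert u T \<subseteq> verts G" using Tu copies_subset by blast
    then show "?f ` insert u T \<subseteq> verts G" using V im by auto
    show "inj_on ?f (insert u T)" using uv by (auto simp: inj_on_def)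
    show "{a, b} \<in> edges G \<longleftrightarrow> {?f a, ?f b} \<in> edges G" 
      if "a \<in> insert u T" "b \<in> insert u T" for a b
    proof -
      have "{u, v} \<notin> edges G" using twins_nonadjacent[OF G tw] .
      moreover have "{u, c} \<in> edges G \<longleftrightarrow> {v, c} \<in> edges G" "{c, u} \<in> edges G \<longleftrightarrow> {c, v} \<in> edges G" for c
        using tw by (simp_all add: twins_def insert_commute)
      ultimately show ?thesis using no_loops[OF G, of u] no_loops[OF G, of v] by simp
    qed
  qed
  then show "T \<in> link (copies F G) {u, v} {v}"
    using Tu uv im by (simp add: link_def)
qed

lemma coef_twins:
  assumes "simple_graph G" "twins G u v" "u \<in> verts G" "v \<in> verts G"
  shows "coef F G {u, v} {u} x = coef F G {u, v} {v} x"
proof -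
  have "twins G v u" using assms by (simp add: twins_def)
  then have "link (copies F G) {u, v} {u} = link (copies F G) {u, v} {v}"
    using link_twins[OF assms] link_twins[of G v u] assms
    unfolding insert_commute[of v u] by blast
  then show ?thesis by (simp add: coef_def)
qed

text \<open>The coefficients of \<open>x u\<close> and \<open>x v\<close> agree, so only the sum and the product of the two entries
  matter; both grow when the entries are replaced by a common value that is at least their mean.\<close>

lemma ind_poly_average_twins:
  assumes G: "simple_graph G" and tw: "twins G u v" and V: "u \<in> verts G" "v \<in> verts G" "u \<noteq> v"
    and x: "\<And>i. i \<in> verts G \<Longrightarrow> x i \<ge> 0" and m: "(x u + x v) / 2 \<le> m"
  shows "ind_poly F G x \<le> ind_poly F G (x(u := m, v := m))"
proof -
  define c where "c = (\<lambda>X. coef F G {u, v} X x)"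
  have c_eq: "coef F G {u, v} X (x(u := m, v := m)) = c X" for X
    unfolding c_def by (rule coef_cong) auto
  have c0: "c X \<ge> 0" for X
    unfolding c_def using x by (intro coef_nonneg) auto
  have cu: "c {v} = c {u}"
    unfolding c_def using coef_twins[OF G tw V(1,2)] by metis
  have "x u * x v \<le> ((x u + x v) / 2)\<^sup>2"
    using sum_squares_ge_zero[of "x u - x v" 0] by (simp add: power2_eq_square field_simps)
  also have "\<dots> \<le> m\<^sup>2" using m x V by (intro power_mono) auto
  finally have prod: "x u * x v \<le> m * m" by (simp add: power2_eq_square)
  have "x u * c {u} + x v * c {u} \<le> m * c {u} + m * c {u}"
    using mult_right_mono[OF _ c0[of "{u}"], of "x u + x v" "m + m"] m by (simp add: algebra_simps)
  moreover have "x u * x v * c {u, v} \<le> m * m * c {u, v}"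
    using prod c0 by (intro mult_right_mono) auto
  ultimately show ?thesis
    unfolding ind_poly_two_variables[OF G V(3)] c_eq using V(3) cu
    by (intro mult_left_mono) (simp_all add: c_def)
qed

text \<open>Choosing the optimum that minimises the strictly convex function \<open>Q\<close> (in the variables
  \<open>x i powr \<alpha>\<close>) replaces an infinite sequence of averaging steps by a single one.\<close>

theorem exists_optimum_constant_on_parts:
  assumes G: "simple_graph G" "verts G \<noteq> {}" and mp: "multipartition G P" and \<alpha>: "\<alpha> \<ge> 1"
  shows "\<exists>x\<in>OPT \<alpha> F G. \<forall>A\<in>P. \<forall>u\<in>A. \<forall>v\<in>A. x u = x v"
proof -
  define V where "V = verts G"
  have fin: "finite V" using G by (simp add: V_def simple_graph_def)
  define K where "K = ext_sphere \<alpha> V \<inter> {x. ind_poly F G x = lam_ind \<alpha> F G}"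
  define Q where "Q = (\<lambda>x :: 'a \<Rightarrow> real. \<Sum>i\<in>V. (\<bar>x i\<bar> powr \<alpha>)\<^sup>2)"
  have "compact K"
    unfolding K_def using \<alpha>
    by (intro compact_Int_closed compact_ext_sphere closed_Collect_eq continuous_on_ind_poly) auto
  moreover have "K \<noteq> {}"
    unfolding K_def V_def using lam_ind_attained(1)[OF G, of \<alpha> F] \<alpha> by auto
  moreover have "continuous_on K Q"
    unfolding Q_def using \<alpha>
    by (intro continuous_on_sum continuous_on_power continuous_on_abs_powr_coordinate) auto
  ultimately obtain x where x: "x \<in> K" and min: "\<And>y. y \<in> K \<Longrightarrow> Q x \<le> Q y"
    using continuous_attains_inf[of K Q] by blast
  have nonneg: "x i \<ge> 0" for i
    using x by (cases "i \<in> V") (auto simp: K_def ext_sphere_def)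
  have "x u = x v" if A: "A \<in> P" "u \<in> A" "v \<in> A" for A u v
  proof (rule ccontr)
    assume neq: "x u \<noteq> x v"
    have V: "u \<in> V" "v \<in> V" "u \<noteq> v"
      using A mp neq by (auto simp: V_def multipartition_def partition_on_def)
    define a b where "a = x u powr \<alpha>" and "b = x v powr \<alpha>"
    define m where "m = ((a + b) / 2) powr (1 / \<alpha>)"
    have m0: "m \<ge> 0" by (simp add: m_def)
    have m_powr: "m powr \<alpha> = (a + b) / 2"
      using \<alpha> by (simp add: m_def powr_powr a_def b_def)
    have mean: "(x u + x v) / 2 \<le> m"
      using power_mean_le[of "{u, v}" x \<alpha>] V nonneg \<alpha> by (simp add: m_def a_def b_def)
    define y where "y = x(u := m, v := m)"
    (* used for the constraint and for Q alike *)
    have split: "(\<Sum>i\<in>V. h (z i)) = h (z u) + h (z v) + (\<Sum>i\<in>V - {u, v}. h (z i))"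
      for h :: "real \<Rightarrow> real" and z :: "'a \<Rightarrow> real"
    proof -
      have "V = insert u (insert v (V - {u, v}))" using V by auto
      then have "(\<Sum>i\<in>V. h (z i)) = (\<Sum>i\<in>insert u (insert v (V - {u, v})). h (z i))" by simp
      then show ?thesis using V fin by (simp add: add.assoc)
    qed
    have rest: "(\<Sum>i\<in>V - {u, v}. h (y i)) = (\<Sum>i\<in>V - {u, v}. h (x i))" for h :: "real \<Rightarrow> real"
      by (rule sum.cong) (auto simp: y_def)
    have y_uv: "y u = m" "y v = m" by (simp_all add: y_def)
    have norm: "(\<Sum>i\<in>V. \<bar>y i\<bar> powr \<alpha>) = 1"
    proof -
      have "(\<Sum>i\<in>V. \<bar>y i\<bar> powr \<alpha>) = (\<Sum>i\<in>V. \<bar>x i\<bar> powr \<alpha>)"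
        unfolding split[of "\<lambda>t. \<bar>t\<bar> powr \<alpha>"] rest[of "\<lambda>t. \<bar>t\<bar> powr \<alpha>"] y_uv
        using m0 m_powr nonneg by (simp add: a_def b_def)
      also have "\<dots> = 1" using x unfolding K_def ext_sphere_def by blast
      finally show ?thesis .
    qed
    have "ind_poly F G y = lam_ind \<alpha> F G"
    proof (rule antisym)
      show "ind_poly F G y \<le> lam_ind \<alpha> F G"
        using norm \<alpha> by (intro lam_ind_attained(2)[OF G]) (auto simp: V_def)
      have "ind_poly F G x \<le> ind_poly F G y"
        unfolding y_def using twins_if_same_part[OF G(1) mp A] V nonneg mean
        by (intro ind_poly_average_twins[OF G(1)]) (auto simp: V_def)
      then show "lam_ind \<alpha> F G \<le> ind_poly F G y" using x by (simp add: K_def)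
    qed
    moreover have "y \<in> ext_sphere \<alpha> V"
    proof -
      have "\<bar>m\<bar> powr \<alpha> \<le> 1"
        using norm member_le_sum[of u V "\<lambda>i. \<bar>y i\<bar> powr \<alpha>"] V fin y_uv by simp
      moreover have "1 < m powr \<alpha>" if "1 < m" using that \<alpha> by (intro gr_one_powr) auto
      ultimately have "m \<le> 1" using m0 by fastforce
      then show ?thesis
        using x V m0 norm by (auto simp: K_def ext_sphere_def y_def split: if_splits)
    qed
    ultimately have "Q x \<le> Q y" by (intro min) (simp add: K_def)
    (* a^2 + b^2 exceeds twice the square of the mean of a and b *)
    moreover have "Q x - Q y = (a - b)\<^sup>2 / 2"
      unfolding Q_def split[of "\<lambda>t. (\<bar>t\<bar> powr \<alpha>)\<^sup>2"] rest[of "\<lambda>t. (\<bar>t\<bar> powr \<alpha>)\<^sup>2"] y_uv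
      using m0 nonneg by (simp add: m_powr a_def[symmetric] b_def[symmetric] power2_eq_square field_simps)
    moreover have "a powr (1 / \<alpha>) = x u" "b powr (1 / \<alpha>) = x v"
      using nonneg \<alpha> by (simp_all add: a_def b_def powr_powr)
    then have "a \<noteq> b" using neq by auto
    then have "(a - b)\<^sup>2 > 0" by simp
    ultimately show False by simp
  qed
  moreover have "x \<in> OPT \<alpha> F G"
    using x ext_sphere_subset[of \<alpha> G] by (auto simp: K_def V_def OPT_def)
  ultimately show ?thesis by blast
qed

section \<open>Symmetrisation by cloning\<close>

text \<open>Vertex \<open>v\<close> becomes a copy of vertex \<open>u\<close>: it takes over the neighbourhood of \<open>u\<close>.\<close>

definition clone :: "'v ugraph \<Rightarrow> 'v \<Rightarrow> 'v \<Rightarrow> 'v ugraph" where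
  "clone G u v = pullback (id(v := u)) (verts G) G"

lemma verts_clone [simp]: "verts (clone G u v) = verts G"
  by (simp add: clone_def)

lemma simple_graph_clone: "simple_graph G \<Longrightarrow> simple_graph (clone G u v)"
  unfolding clone_def by (rule simple_graph_pullback) (simp_all add: simple_graph_def)

lemma copies_clone_iff:
  assumes V: "u \<in> verts G" "v \<in> verts G" and inj: "inj_on (id(v := u)) S"
  shows "S \<in> copies F (clone G u v) \<longleftrightarrow> id(v := u) ` S \<in> copies F G"
proof (cases "S \<subseteq> verts G")
  case True
  then have "id(v := u) ` S \<subseteq> verts G" using V by auto
  then show ?thesis unfolding clone_def by (rule copies_pullback_iff[OF True inj])
next
  case False
  then have "\<not> id(v := u) ` S \<subseteq> verts G" using V by auto
  then show ?thesis using False copies_subset[of _ F G] copies_subset[of _ F "clone G u v"] by auto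
qed

text \<open>This is how the structure of \<open>F\<close> enters: within a copy, nonadjacent vertices are twins.\<close>

lemma copy_nonadj_trans:
  assumes F: "nonadj_trans F" and S: "S \<in> copies F G"
    and abc: "a \<in> S" "b \<in> S" "c \<in> S" "{a, b} \<notin> edges G" "{b, c} \<notin> edges G"
  shows "{a, c} \<notin> edges G"
proof -
  obtain g where g: "bij_betw g S (verts F)"
    "\<forall>a\<in>S. \<forall>b\<in>S. {a, b} \<in> edges G \<longleftrightarrow> {g a, g b} \<in> edges F"
    using S unfolding copies_iff by blast
  have "g a \<in> verts F" "g b \<in> verts F" "g c \<in> verts F"
    using abc g(1) bij_betwE by blast+
  moreover have "{g a, g b} \<notin> edges F" "{g b, g c} \<notin> edges F" using abc g(2) by blast+
  ultimately have "{g a, g c} \<notin> edges F" using F unfolding nonadj_trans_def by blast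
  then show ?thesis using abc g(2) by blast
qed

lemma link_clone:
  assumes V: "u \<in> verts G" "v \<in> verts G" and "u \<noteq> v"
  shows "link (copies F (clone G u v)) {u, v} {} = link (copies F G) {u, v} {}"
    and "link (copies F (clone G u v)) {u, v} {u} = link (copies F G) {u, v} {u}"
    and "link (copies F (clone G u v)) {u, v} {v} = link (copies F G) {u, v} {u}"
proof -
  have *: "T \<union> X \<in> copies F (clone G u v) \<longleftrightarrow> T \<union> id(v := u) ` X \<in> copies F G"
    if T: "T \<inter> {u, v} = {}" and X: "X \<in> {{}, {u}, {v}}" for T X
  proof -
    have "inj_on (id(v := u)) (T \<union> X)" "id(v := u) ` (T \<union> X) = T \<union> id(v := u) ` X"
      using T X \<open>u \<noteq> v\<close> by (auto simp: inj_on_def)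
    then show ?thesis using copies_clone_iff[OF V] by metis
  qed
  show "link (copies F (clone G u v)) {u, v} {} = link (copies F G) {u, v} {}"
    unfolding link_def using *[of _ "{}"] by auto
  show "link (copies F (clone G u v)) {u, v} {u} = link (copies F G) {u, v} {u}"
    unfolding link_def using *[of _ "{u}"] \<open>u \<noteq> v\<close> by auto
  show "link (copies F (clone G u v)) {u, v} {v} = link (copies F G) {u, v} {u}"
    unfolding link_def using *[of _ "{v}"] by auto
qed

text \<open>A copy through both vertices sees them as twins already, so on its vertex set cloning does not
  change any adjacency.\<close>

lemma link_clone_both:
  assumes F: "nonadj_trans F" and G: "simple_graph G"
    and V: "u \<in> verts G" "v \<in> verts G" and nonadj: "{u, v} \<notin> edges G"
  shows "link (copies F G) {u, v} {u, v} \<subseteq> link (copies F (clone G u v)) {u, v} {u, v}"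
proof
  fix T assume T: "T \<in> link (copies F G) {u, v} {u, v}"
  define S where "S = T \<union> {u, v}"
  have S: "S \<in> copies F G" "u \<in> S" "v \<in> S" using T by (auto simp: link_def S_def)
  have SV: "S \<subseteq> verts G" using S(1) by (rule copies_subset)
  have tw: "{u, c} \<in> edges G \<longleftrightarrow> {v, c} \<in> edges G" if "c \<in> S" for c
    using copy_nonadj_trans[OF F S(1)] S(2,3) that nonadj insert_commute[of u v "{}"] by metis
  have "S \<in> copies F (clone G u v) \<longleftrightarrow> id ` S \<in> copies F G"
  proof (rule copies_transfer)
    fix a b assume ab: "a \<in> S" "b \<in> S"
    have "{a, b} \<in> edges (clone G u v) \<longleftrightarrow> {(id(v := u)) a, (id(v := u)) b} \<in> edges G"
      unfolding clone_def using ab SV by (intro edge_pullback_iff) auto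
    also have "\<dots> \<longleftrightarrow> {a, b} \<in> edges G"
      using tw[OF ab(1)] tw[OF ab(2)] no_loops[OF G, of u] no_loops[OF G, of v]
      by (cases "a = v"; cases "b = v") (simp_all add: insert_commute)
    finally show "{a, b} \<in> edges (clone G u v) \<longleftrightarrow> {id a, id b} \<in> edges G" by simp
  qed (use SV in auto)
  then show "T \<in> link (copies F (clone G u v)) {u, v} {u, v}"
    using S(1) T by (simp add: link_def S_def)
qed

text \<open>After cloning, \<open>x v\<close> is multiplied by the coefficient that belonged to \<open>x u\<close>, and the mixed term
  does not decrease.\<close>

lemma ind_poly_clone_ge:
  assumes F: "nonadj_trans F" and G: "simple_graph G"
    and V: "u \<in> verts G" "v \<in> verts G" "u \<noteq> v" and nonadj: "{u, v} \<notin> edges G"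
    and x: "\<And>i. i \<in> verts G \<Longrightarrow> x i \<ge> 0"
  shows "ind_poly F (clone G u v) x \<ge> ind_poly F G x +
    fact (card (verts F)) * x v * (coef F G {u, v} {u} x - coef F G {u, v} {v} x)"
proof -
  define c where "c = (\<lambda>X. coef F G {u, v} X x)"
  define d where "d = coef F (clone G u v) {u, v} {u, v} x"
  have "c {u, v} \<le> d"
    unfolding c_def d_def using x G link_clone_both[OF F G V(1,2) nonadj]
    by (intro coef_mono simple_graph_clone) auto
  then have le: "x u * x v * c {u, v} \<le> x u * x v * d"
    using x V by (intro mult_left_mono) auto
  have clone: "ind_poly F (clone G u v) x = fact (card (verts F)) *
      (c {} + x u * c {u} + x v * c {u} + x u * x v * d)"
    unfolding ind_poly_two_variables[OF simple_graph_clone[OF G] V(3)] c_def d_def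
    by (simp add: coef_def link_clone[OF V])
  have "ind_poly F G x + fact (card (verts F)) * x v * (c {u} - c {v}) =
      fact (card (verts F)) * (c {} + x u * c {u} + x v * c {u} + x u * x v * c {u, v})"
    unfolding ind_poly_two_variables[OF G V(3)] c_def by (simp add: algebra_simps)
  also have "\<dots> \<le> ind_poly F (clone G u v) x"
    unfolding clone using le by (intro mult_left_mono) auto
  finally show ?thesis by (simp add: c_def)
qed

definition maximal_at :: "'a ugraph \<Rightarrow> nat \<Rightarrow> (nat \<Rightarrow> real) \<Rightarrow> nat ugraph set" where
  "maximal_at F n x = {G \<in> graphs_on n. \<forall>H\<in>graphs_on n. ind_poly F H x \<le> ind_poly F G x}"

text \<open>Maximality forbids a gain in either direction. Positivity of both \<open>x u\<close> and \<open>x v\<close> then forces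
  the two linear coefficients to be equal, so that cloning loses nothing.\<close>

lemma maximal_at_clone:
  assumes F: "nonadj_trans F" and G: "G \<in> maximal_at F n x"
    and uv: "u < n" "v < n" "u \<noteq> v" "{u, v} \<notin> edges G"
    and x: "\<And>i. i < n \<Longrightarrow> x i > 0"
  shows "clone G u v \<in> maximal_at F n x"
proof -
  define k :: real where "k = fact (card (verts F))"
  have k: "k > 0" by (simp add: k_def)
  have simple: "simple_graph G" and V: "verts G = {..<n}"
    using G by (auto simp: maximal_at_def graphs_on_def)
  have clone_in: "clone G a b \<in> graphs_on n" for a b
    using simple_graph_clone[OF simple] V by (simp add: graphs_on_def)
  have max: "ind_poly F (clone G a b) x \<le> ind_poly F G x" for a b
    using G clone_in by (simp add: maximal_at_def)
  define cu cv where "cu = coef F G {u, v} {u} x" and "cv = coef F G {u, v} {v} x"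
  have ge: "ind_poly F (clone G u v) x \<ge> ind_poly F G x + k * x v * (cu - cv)"
    unfolding k_def cu_def cv_def using uv x V simple
    by (intro ind_poly_clone_ge[OF F]) (auto intro: less_imp_le)
  have "ind_poly F (clone G v u) x \<ge> ind_poly F G x + k * x u * (cv - cu)"
    unfolding k_def cu_def cv_def insert_commute[of u v "{}"] using uv x V simple
    by (intro ind_poly_clone_ge[OF F]) (auto intro: less_imp_le simp: insert_commute)
  then have "k * x u * (cv - cu) \<le> 0" using max[of v u] by linarith
  then have "cv \<le> cu" using k x[OF uv(1)] by (simp add: mult_le_0_iff)
  then have "k * x v * (cu - cv) \<ge> 0" using k x[OF uv(2)] by simp
  then have "ind_poly F G x \<le> ind_poly F (clone G u v) x" using ge by linarith
  then show ?thesis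
    using G clone_in order_trans by (fastforce simp: maximal_at_def)
qed

definition twin_pairs :: "'v ugraph \<Rightarrow> ('v \<times> 'v) set" where
  "twin_pairs G = {(a, b). a \<in> verts G \<and> b \<in> verts G \<and> twins G a b}"

lemma finite_twin_pairs: "simple_graph G \<Longrightarrow> finite (twin_pairs G)"
  by (rule finite_subset[of _ "verts G \<times> verts G"]) (auto simp: twin_pairs_def simple_graph_def)

lemma twins_clone:
  assumes G: "simple_graph G" and ab: "a \<in> verts G" "b \<in> verts G"
    and tw: "twins G ((id(v := u)) a) ((id(v := u)) b)"
  shows "twins (clone G u v) a b"
proof -
  have "{a, c} \<in> edges (clone G u v) \<longleftrightarrow> {b, c} \<in> edges (clone G u v)" for c
  proof (cases "c \<in> verts G")
    case True
    then show ?thesis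
      using tw edge_pullback_iff[OF ab(1) True] edge_pullback_iff[OF ab(2) True]
      unfolding twins_def clone_def by metis
  next
    case False
    then show ?thesis using edge_in_verts[OF simple_graph_clone[OF G]] by (metis verts_clone)
  qed
  then show ?thesis by (simp add: twins_def)
qed

text \<open>Twins other than \<open>v\<close> stay twins. Writing \<open>W\<close> and \<open>U\<close> for the twin classes of \<open>v\<close> and \<open>u\<close>, the
  move destroys the \<open>2 |W| - 1\<close> pairs that involve \<open>v\<close> and creates at least \<open>2 |U|\<close> new ones, besides
  the pair of \<open>v\<close> with itself.\<close>

lemma card_twin_pairs_clone:
  assumes G: "simple_graph G" and V: "u \<in> verts G" "v \<in> verts G" and nt: "\<not> twins G u v"
    and le: "card {w \<in> verts G. twins G v w} \<le> card {w \<in> verts G. twins G u w}"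
  shows "card (twin_pairs G) < card (twin_pairs (clone G u v))"
proof -
  define U where "U = {w \<in> verts G. twins G u w}"
  define W where "W = {w \<in> verts G. twins G v w}"
  define R where "R = {(a, b). a \<in> verts G - {v} \<and> b \<in> verts G - {v} \<and> twins G a b}"
  have fin: "finite (verts G)" using G by (simp add: simple_graph_def)
  then have finU: "finite U" and finW: "finite W" by (auto simp: U_def W_def)
  have finR: "finite R"
    by (rule finite_subset[OF _ finite_cartesian_product[OF fin fin]]) (auto simp: R_def)
  have vU: "v \<notin> U" using nt by (simp add: U_def)
  have vW: "v \<in> W" using V by (simp add: W_def twins_def)
  have "twin_pairs G \<subseteq> R \<union> ({v} \<times> W \<union> (W - {v}) \<times> {v})"
    by (auto simp: twin_pairs_def R_def W_def twins_def)
  then have "card (twin_pairs G) \<le> card (R \<union> ({v} \<times> W \<union> (W - {v}) \<times> {v}))"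
    by (intro card_mono) (use finR finW in auto)
  also have "\<dots> \<le> card R + (card ({v} \<times> W) + card ((W - {v}) \<times> {v}))"
    by (intro order_trans[OF card_Un_le] add_left_mono card_Un_le)
  also have "\<dots> = card R + card W + (card W - 1)"
    using vW finW by (simp add: card_cartesian_product)
  also have "\<dots> < card R + card W + card W"
    using card_gt_0_iff[of W] vW finW by auto
  also have "\<dots> \<le> card R + (card ({v} \<times> U) + card (U \<times> {v}))"
    using le by (simp add: card_cartesian_product U_def W_def)
  also have "\<dots> = card (R \<union> ({v} \<times> U \<union> U \<times> {v}))"
  proof -
    have "R \<inter> ({v} \<times> U \<union> U \<times> {v}) = {}" "{v} \<times> U \<inter> U \<times> {v} = {}"
      using vU by (auto simp: R_def)
    then show ?thesis using finR finU by (simp add: card_Un_disjoint)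
  qed
  also have "\<dots> \<le> card (twin_pairs (clone G u v))"
  proof (intro card_mono finite_twin_pairs simple_graph_clone G subsetI)
    fix p assume p: "p \<in> R \<union> ({v} \<times> U \<union> U \<times> {v})"
    obtain a b where [simp]: "p = (a, b)" by fastforce
    have "a \<in> verts G" "b \<in> verts G" using p V by (auto simp: R_def U_def)
    moreover have "twins G ((id(v := u)) a) ((id(v := u)) b)"
      using p vU by (auto simp: R_def U_def twins_def)
    ultimately show "p \<in> twin_pairs (clone G u v)"
      using twins_clone[OF G] by (simp add: twin_pairs_def)
  qed
  finally show ?thesis .
qed

lemma finite_graphs_on: "finite (graphs_on n)"
  by (rule finite_subset[of _ "{{..<n}} \<times> Pow (Pow {..<n})"])
     (fastforce simp: graphs_on_def simple_graph_def)+

lemma graphs_on_nonempty: "graphs_on n \<noteq> {}"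
  by (auto simp: graphs_on_def simple_graph_def intro!: exI[of _ "{}"])

lemma finite_has_maximiser:
  fixes f :: "'b \<Rightarrow> 'c :: linorder"
  assumes "finite S" "S \<noteq> {}"
  shows "\<exists>m\<in>S. \<forall>s\<in>S. f s \<le> f m"
proof -
  obtain m where m: "m \<in> S" "Max (f ` S) = f m"
    using Max_in[of "f ` S"] assms by blast
  have "f s \<le> f m" if "s \<in> S" for s
    using Max_ge[of "f ` S" "f s"] assms(1) that m(2) by simp
  then show ?thesis using m(1) by blast
qed

text \<open>In a maximal graph with the most twin pairs any two nonadjacent vertices are twins: otherwise
  cloning the one with the smaller twin class would stay maximal and add twin pairs.\<close>

lemma multipartite_maximiser_positive:
  assumes F: "nonadj_trans F" and x: "\<And>i. i < n \<Longrightarrow> x i > 0"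
  shows "\<exists>G\<in>maximal_at F n x. nonadj_trans G"
proof -
  have "finite (maximal_at F n x)"
    using finite_graphs_on by (simp add: maximal_at_def)
  moreover have "maximal_at F n x \<noteq> {}"
    using finite_has_maximiser[OF finite_graphs_on graphs_on_nonempty, of n "\<lambda>G. ind_poly F G x"]
    by (auto simp: maximal_at_def)
  ultimately obtain G where G: "G \<in> maximal_at F n x"
    and most: "\<And>H. H \<in> maximal_at F n x \<Longrightarrow> card (twin_pairs H) \<le> card (twin_pairs G)"
    using finite_has_maximiser[of _ "\<lambda>G. card (twin_pairs G)"] by metis
  have simple: "simple_graph G" and V: "verts G = {..<n}"
    using G by (auto simp: maximal_at_def graphs_on_def)
  have no_gain: "twins G u v" 
    if uv: "u < n" "v < n" "{u, v} \<notin> edges G"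
      and le: "card {w \<in> verts G. twins G v w} \<le> card {w \<in> verts G. twins G u w}" for u v
  proof (rule ccontr)
    assume nt: "\<not> twins G u v"
    then have "u \<noteq> v" by (auto simp: twins_def)
    then have "clone G u v \<in> maximal_at F n x"
      using maximal_at_clone[OF F G] uv x by blast
    moreover have "card (twin_pairs G) < card (twin_pairs (clone G u v))"
      using card_twin_pairs_clone[OF simple _ _ nt le] uv V by simp
    ultimately show False using most leD by blast
  qed
  have tw: "twins G u v" if "u < n" "v < n" "{u, v} \<notin> edges G" for u v
  proof (cases "card {w \<in> verts G. twins G v w} \<le> card {w \<in> verts G. twins G u w}")
    case True
    then show ?thesis using no_gain that by blast
  next
    case False
    then have "twins G v u" using no_gain[of v u] that by (simp add: insert_commute)
    then show ?thesis by (simp add: twins_def)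
  qed
  have "nonadj_trans G"
    unfolding nonadj_trans_def V using tw unfolding twins_def by blast
  then show ?thesis using G by blast
qed

lemma tendsto_ind_poly_shift:
  "((\<lambda>\<epsilon>. ind_poly F G (\<lambda>i. x i + \<epsilon>)) \<longlongrightarrow> ind_poly F G x) (at_right 0)"
proof -
  have "((\<lambda>\<epsilon>. ind_poly F G (\<lambda>i. x i + \<epsilon>)) \<longlongrightarrow> ind_poly F G (\<lambda>i. x i + 0)) (at_right 0)"
    unfolding ind_poly_def by (intro tendsto_intros)
  then show ?thesis by simp
qed

text \<open>If every complete multipartite graph were strictly worse than \<open>G\<close> at \<open>x\<close>, then, these being
  finitely many and the values continuous, the same would hold at the positive vector \<open>x + \<epsilon>\<close>
  for small \<open>\<epsilon>\<close>.\<close>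

lemma multipartite_dominates:
  assumes F: "nonadj_trans F" and G: "G \<in> graphs_on n" and x: "\<And>i. i < n \<Longrightarrow> x i \<ge> 0"
  shows "\<exists>H\<in>graphs_on n. nonadj_trans H \<and> ind_poly F G x \<le> ind_poly F H x"
proof (rule ccontr)
  assume contra: "\<not> ?thesis"
  define N where "N = {H \<in> graphs_on n. nonadj_trans H}"
  have "\<forall>\<^sub>F \<epsilon> in at_right 0. ind_poly F H (\<lambda>i. x i + \<epsilon>) < ind_poly F G (\<lambda>i. x i + \<epsilon>)" if H: "H \<in> N" for H
  proof -
    have "0 < ind_poly F G x - ind_poly F H x" using contra H by (auto simp: N_def not_le)
    then have "\<forall>\<^sub>F \<epsilon> in at_right 0. 0 < ind_poly F G (\<lambda>i. x i + \<epsilon>) - ind_poly F H (\<lambda>i. x i + \<epsilon>)"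
      by (rule order_tendstoD(1)[OF tendsto_diff[OF tendsto_ind_poly_shift tendsto_ind_poly_shift]])
    then show ?thesis by eventually_elim simp
  qed
  moreover have "finite N" using finite_graphs_on by (simp add: N_def)
  ultimately have "\<forall>\<^sub>F \<epsilon> in at_right 0. \<forall>H\<in>N. ind_poly F H (\<lambda>i. x i + \<epsilon>) < ind_poly F G (\<lambda>i. x i + \<epsilon>)"
    by (simp add: eventually_ball_finite_distrib)
  then have "\<forall>\<^sub>F \<epsilon> in at_right (0::real). \<epsilon> > 0 \<and>
      (\<forall>H\<in>N. ind_poly F H (\<lambda>i. x i + \<epsilon>) < ind_poly F G (\<lambda>i. x i + \<epsilon>))"
    by (intro eventually_conj eventually_at_right_less)
  then obtain \<epsilon> :: real where \<epsilon>: "\<epsilon> > 0"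
      "\<And>H. H \<in> N \<Longrightarrow> ind_poly F H (\<lambda>i. x i + \<epsilon>) < ind_poly F G (\<lambda>i. x i + \<epsilon>)"
    using eventually_happens'[OF trivial_limit_at_right_real] by blast
  have "\<exists>H\<in>maximal_at F n (\<lambda>i. x i + \<epsilon>). nonadj_trans H"
    using x \<epsilon>(1) by (intro multipartite_maximiser_positive[OF F] add_nonneg_pos) auto
  then obtain H where H: "H \<in> maximal_at F n (\<lambda>i. x i + \<epsilon>)" "nonadj_trans H" by blast
  then have "ind_poly F G (\<lambda>i. x i + \<epsilon>) \<le> ind_poly F H (\<lambda>i. x i + \<epsilon>)" "H \<in> N"
    using G by (auto simp: maximal_at_def N_def)
  then show False using \<epsilon>(2) by (meson leD)
qed

lemma lam_ind_le_spec_ind: "G \<in> graphs_on n \<Longrightarrow> lam_ind \<alpha> F G \<le> spec_ind \<alpha> F n"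
  unfolding spec_ind_def using finite_graphs_on by (intro Max_ge) auto

theorem exists_multipartite_extremal:
  assumes F: "nonadj_trans F" and n: "n \<ge> 1" and \<alpha>: "\<alpha> > 0"
  shows "\<exists>G\<in>graphs_on n. complete_multipartite G \<and> lam_ind \<alpha> F G = spec_ind \<alpha> F n"
proof -
  have fin: "finite (lam_ind \<alpha> F ` graphs_on n)" using finite_graphs_on by blast
  have "spec_ind \<alpha> F n \<in> lam_ind \<alpha> F ` graphs_on n"
    unfolding spec_ind_def using fin graphs_on_nonempty by (intro Max_in) auto
  then obtain G where G: "G \<in> graphs_on n" "lam_ind \<alpha> F G = spec_ind \<alpha> F n" by auto
  have sg: "simple_graph H \<and> verts H = {..<n} \<and> verts H \<noteq> {}" if "H \<in> graphs_on n" for H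
    using that n by (auto simp: graphs_on_def lessThan_empty_iff)
  obtain x where x: "x \<in> ext_sphere \<alpha> (verts G)" "ind_poly F G x = lam_ind \<alpha> F G"
    using lam_ind_attained(1)[OF _ _ \<alpha>] sg[OF G(1)] by blast
  have "x i \<ge> 0" if "i < n" for i using x(1) sg[OF G(1)] that by (auto simp: ext_sphere_def)
  then obtain H where H: "H \<in> graphs_on n" "nonadj_trans H" "ind_poly F G x \<le> ind_poly F H x"
    using multipartite_dominates[OF F G(1)] by blast
  have "ind_poly F H x \<le> lam_ind \<alpha> F H"
    using sg[OF H(1)] sg[OF G(1)] x(1) by (intro lam_ind_attained(2) \<alpha>) (auto simp: ext_sphere_def)
  then have "lam_ind \<alpha> F H = spec_ind \<alpha> F n"
    using lam_ind_le_spec_ind[OF H(1), of \<alpha> F] G(2) H(3) x(2) by simp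
  moreover have "complete_multipartite H"
    using complete_multipartite_if_nonadj_trans sg[OF H(1)] H(2) by blast
  ultimately show ?thesis using H(1) by blast
qed

section \<open>Blow-ups and the inducibility\<close>

text \<open>Choosing one vertex from the fibre over each vertex of a copy in \<open>G\<close> gives a copy in the
  pullback, and different choices give different vertex sets.\<close>

lemma card_copies_pullback_ge:
  assumes G: "simple_graph G" and W: "finite W"
  shows "(\<Sum>e\<in>copies F G. \<Prod>i\<in>e. card {a \<in> W. \<phi> a = i}) \<le> card (copies F (pullback \<phi> W G))"
proof -
  define fibre where "fibre = (\<lambda>i. {a \<in> W. \<phi> a = i})"
  define sections where "sections = (SIGMA e:copies F G. PiE e fibre)"
  have fib: "\<phi> (s i) = i" "s i \<in> W" if "s \<in> PiE e fibre" "i \<in> e" for s e i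
    using PiE_mem[OF that] by (auto simp: fibre_def)
  have \<phi>_section: "\<phi> ` s ` e = e" if "s \<in> PiE e fibre" for s e
    using fib(1)[OF that] by force
  have inj: "inj_on (\<lambda>(e, s). s ` e) sections"
  proof (rule inj_onI)
    fix p q assume p: "p \<in> sections" and q: "q \<in> sections" and eq: "(\<lambda>(e, s). s ` e) p = (\<lambda>(e, s). s ` e) q"
    obtain e s where ps: "p = (e, s)" "s \<in> PiE e fibre" using p by (auto simp: sections_def)
    obtain e' s' where qs: "q = (e', s')" "s' \<in> PiE e' fibre" using q by (auto simp: sections_def)
    have im: "s ` e = s' ` e'" using eq ps qs by simp
    then have e: "e = e'" using \<phi>_section ps(2) qs(2) by metis
    have "s i = s' i" if i: "i \<in> e" for i
    proof -
      have "s i \<in> s' ` e'" using i im by blast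
      then obtain j where j: "j \<in> e'" "s i = s' j" by blast
      then have "i = j" using fib(1)[OF ps(2) i] fib(1)[OF qs(2) j(1)] by simp
      then show ?thesis using j by simp
    qed
    then have "s = s'" using ps(2) qs(2) e by (intro PiE_ext[of s e _ s']) auto
    then show "p = q" using ps qs e by simp
  qed
  have sub: "(\<lambda>(e, s). s ` e) ` sections \<subseteq> copies F (pullback \<phi> W G)"
  proof clarify
    fix e s assume "(e, s) \<in> sections"
    then have e: "e \<in> copies F G" and s: "s \<in> PiE e fibre" by (auto simp: sections_def)
    have "inj_on \<phi> (s ` e)" using fib(1)[OF s] by (auto simp: inj_on_def)
    moreover have "s ` e \<subseteq> W" using fib(2)[OF s] by blast
    ultimately show "s ` e \<in> copies F (pullback \<phi> W G)"
      using copies_pullback_iff[of "s ` e" W \<phi> G F] \<phi>_section[OF s] e copies_subset[OF e] by simp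
  qed
  have "(\<Sum>e\<in>copies F G. \<Prod>i\<in>e. card (fibre i)) = (\<Sum>e\<in>copies F G. card (PiE e fibre))"
    by (intro sum.cong) (auto simp: card_PiE finite_copy[OF G])
  also have "\<dots> = card sections"
    unfolding sections_def using W
    by (subst card_SigmaI) (auto simp: finite_copies[OF G] fibre_def intro!: finite_PiE finite_copy[OF G])
  also have "\<dots> \<le> card (copies F (pullback \<phi> W G))"
    using inj sub finite_copies[OF simple_graph_pullback[OF G W]] by (rule card_inj_on_le)
  finally show ?thesis by (simp add: fibre_def)
qed

text \<open>Disjoint blocks of sizes \<open>m i\<close> fit into \<open>{..<N}\<close>; points outside all blocks may go
  anywhere.\<close>

lemma exists_map_with_fibres:
  fixes m :: "'v \<Rightarrow> nat"
  assumes V: "finite V" "V \<noteq> {}" and m: "(\<Sum>i\<in>V. m i) \<le> N"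
  shows "\<exists>\<phi>. \<forall>i\<in>V. m i \<le> card {a \<in> {..<N}. \<phi> a = i}"
proof -
  define A where "A = (SIGMA i:V. {..<m i})"
  have A: "finite A" "card A \<le> card {..<N}" using V m by (auto simp: A_def)
  obtain h where h: "inj_on h A" "h ` A \<subseteq> {..<N}"
    using card_le_inj[OF A(1) finite_lessThan A(2)] by blast
  have "m i \<le> card {a \<in> {..<N}. fst (inv_into A h a) = i}" if i: "i \<in> V" for i
  proof -
    have sub: "{i} \<times> {..<m i} \<subseteq> A" using i by (auto simp: A_def)
    have "m i = card (h ` ({i} \<times> {..<m i}))"
      using card_image[OF inj_on_subset[OF h(1) sub]] by simp
    also have "\<dots> \<le> card {a \<in> {..<N}. fst (inv_into A h a) = i}"
    proof (rule card_mono)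
      show "h ` ({i} \<times> {..<m i}) \<subseteq> {a \<in> {..<N}. fst (inv_into A h a) = i}"
      proof
        fix a assume "a \<in> h ` ({i} \<times> {..<m i})"
        then obtain j where j: "a = h (i, j)" "(i, j) \<in> A" using sub by blast
        have "inv_into A h a = (i, j)" unfolding j(1) using h(1) j(2) by (rule inv_into_f_f)
        moreover have "a \<in> {..<N}" using h(2) j by blast
        ultimately show "a \<in> {a \<in> {..<N}. fst (inv_into A h a) = i}" by simp
      qed
    qed simp
    finally show ?thesis .
  qed
  then show ?thesis by (intro exI[of _ "\<lambda>a. fst (inv_into A h a)"]) simp
qed

lemma max_copies_ge: "G \<in> graphs_on n \<Longrightarrow> card (copies F G) \<le> max_copies F n"
  unfolding max_copies_def using finite_graphs_on by (intro Max_ge) auto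

lemma max_copies_attained: "\<exists>G\<in>graphs_on n. card (copies F G) = max_copies F n"
proof -
  have "max_copies F n \<in> (\<lambda>G. card (copies F G)) ` graphs_on n"
    unfolding max_copies_def using finite_graphs_on graphs_on_nonempty by (intro Max_in) auto
  then show ?thesis by auto
qed

text \<open>Normalising by \<open>n ^ l / l!\<close> instead of \<open>n choose l\<close> makes this exactly a value of the
  polynomial at a constant vector.\<close>

definition copy_density :: "'a ugraph \<Rightarrow> nat \<Rightarrow> real" where
  "copy_density F n = fact (card (verts F)) * real (max_copies F n) / real n ^ card (verts F)"

lemma ind_poly_const:
  "ind_poly F G (\<lambda>_. c) = fact (card (verts F)) * real (card (copies F G)) * c ^ card (verts F)"
proof -
  have "(\<Sum>e\<in>copies F G. \<Prod>i\<in>e. c) = (\<Sum>e\<in>copies F G. c ^ card (verts F))"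
    by (intro sum.cong) (auto simp: card_copy)
  then show ?thesis by (simp add: ind_poly_def)
qed

lemma ind_poly_scale:
  "ind_poly F G (\<lambda>i. c * x i) = c ^ card (verts F) * ind_poly F G x"
proof -
  have "(\<Sum>e\<in>copies F G. \<Prod>i\<in>e. c * x i) = (\<Sum>e\<in>copies F G. c ^ card (verts F) * (\<Prod>i\<in>e. x i))"
    by (intro sum.cong) (auto simp: card_copy prod.distrib)
  then show ?thesis by (simp add: ind_poly_def sum_distrib_left[symmetric])
qed

text \<open>Blow vertex \<open>i\<close> up into at least \<open>\<lfloor>x i * N\<rfloor>\<close> vertices.\<close>

lemma ind_poly_floor_le_copy_density:
  fixes x :: "'v \<Rightarrow> real"
  assumes G: "simple_graph G" and x: "\<And>i. i \<in> verts G \<Longrightarrow> x i \<ge> 0" "(\<Sum>i\<in>verts G. x i) = 1"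
  shows "ind_poly F G (\<lambda>i. real (nat \<lfloor>x i * real N\<rfloor>) / real N) \<le> copy_density F N"
proof -
  define m where "m = (\<lambda>i. nat \<lfloor>x i * real N\<rfloor>)"
  have fin: "finite (verts G)" using G by (simp add: simple_graph_def)
  have "verts G \<noteq> {}" using x(2) by auto
  moreover have "real (\<Sum>i\<in>verts G. m i) \<le> real N"
  proof -
    have "real (\<Sum>i\<in>verts G. m i) \<le> (\<Sum>i\<in>verts G. x i * real N)"
      unfolding of_nat_sum m_def using x(1) by (intro sum_mono) (simp add: of_nat_floor)
    also have "\<dots> = real N" using x(2) by (simp add: sum_distrib_right[symmetric])
    finally show ?thesis .
  qed
  ultimately obtain \<phi> :: "nat \<Rightarrow> 'v" where \<phi>: "\<forall>i\<in>verts G. m i \<le> card {a \<in> {..<N}. \<phi> a = i}"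
    using exists_map_with_fibres[OF fin, of m N] unfolding of_nat_le_iff by blast
  have "(\<Sum>e\<in>copies F G. \<Prod>i\<in>e. m i) \<le> (\<Sum>e\<in>copies F G. \<Prod>i\<in>e. card {a \<in> {..<N}. \<phi> a = i})"
    using \<phi> copies_subset by (intro sum_mono prod_mono) blast
  also have "\<dots> \<le> card (copies F (pullback \<phi> {..<N} G))"
    by (rule card_copies_pullback_ge[OF G]) simp
  also have "\<dots> \<le> max_copies F N"
    by (intro max_copies_ge) (simp add: graphs_on_def simple_graph_pullback[OF G finite_lessThan])
  finally have le: "real (\<Sum>e\<in>copies F G. \<Prod>i\<in>e. m i) \<le> real (max_copies F N)"
    by (rule of_nat_mono)
  have "ind_poly F G (\<lambda>i. real (m i) / real N) = ind_poly F G (\<lambda>i. (1 / real N) * real (m i))"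
    by simp
  also have "\<dots> = (1 / real N) ^ card (verts F) * ind_poly F G (\<lambda>i. real (m i))"
    by (rule ind_poly_scale)
  also have "\<dots> = fact (card (verts F)) * real (\<Sum>e\<in>copies F G. \<Prod>i\<in>e. m i) / real N ^ card (verts F)"
    by (simp add: ind_poly_def power_one_over)
  also have "\<dots> \<le> copy_density F N"
    unfolding copy_density_def using le by (intro divide_right_mono mult_left_mono) auto
  finally show ?thesis by (simp add: m_def)
qed

lemma tendsto_floor_ratio:
  assumes "x \<ge> 0"
  shows "(\<lambda>N. real (nat \<lfloor>x * real N\<rfloor>) / real N) \<longlonglongrightarrow> x"
proof (rule tendsto_sandwich)
  show "\<forall>\<^sub>F N in sequentially. x - 1 / real N \<le> real (nat \<lfloor>x * real N\<rfloor>) / real N"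
    using eventually_gt_at_top[of 0]
  proof eventually_elim
    case (elim N)
    have "x * real N - 1 \<le> real_of_int \<lfloor>x * real N\<rfloor>" by linarith
    also have "\<dots> = real (nat \<lfloor>x * real N\<rfloor>)" using assms by simp
    finally have "(x * real N - 1) / real N \<le> real (nat \<lfloor>x * real N\<rfloor>) / real N"
      by (rule divide_right_mono) simp
    then show ?case using elim by (simp add: diff_divide_distrib)
  qed
  show "\<forall>\<^sub>F N in sequentially. real (nat \<lfloor>x * real N\<rfloor>) / real N \<le> x"
    using eventually_gt_at_top[of 0]
  proof eventually_elim
    case (elim N)
    have "real (nat \<lfloor>x * real N\<rfloor>) \<le> x * real N" using assms by (simp add: of_nat_floor)
    then show ?case using elim by (simp add: field_simps)
  qed
  show "(\<lambda>N. x - 1 / real N) \<longlonglongrightarrow> x"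
    using tendsto_diff[OF tendsto_const lim_const_over_n[of 1], of x] by simp
qed simp

lemma eventually_copy_density_gt:
  assumes G: "simple_graph G" and x: "\<And>i. i \<in> verts G \<Longrightarrow> x i \<ge> 0" "(\<Sum>i\<in>verts G. x i) = 1"
    and a: "a < ind_poly F G x"
  shows "\<forall>\<^sub>F N in sequentially. a < copy_density F N"
proof -
  have "(\<lambda>N. ind_poly F G (\<lambda>i. real (nat \<lfloor>x i * real N\<rfloor>) / real N)) \<longlonglongrightarrow> ind_poly F G x"
    unfolding ind_poly_def using x(1) copies_subset
    by (intro tendsto_intros tendsto_floor_ratio) blast
  then have "\<forall>\<^sub>F N in sequentially. a < ind_poly F G (\<lambda>i. real (nat \<lfloor>x i * real N\<rfloor>) / real N)"
    using a by (rule order_tendstoD(1))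
  then show ?thesis
    by (rule eventually_mono) (rule less_le_trans[OF _ ind_poly_floor_le_copy_density[OF G x]])
qed

lemma copy_density_le_1: "copy_density F n \<le> 1"
proof -
  define l where "l = card (verts F)"
  obtain G where G: "G \<in> graphs_on n" "card (copies F G) = max_copies F n"
    using max_copies_attained by blast
  have "copies F G \<subseteq> {S. S \<subseteq> {..<n} \<and> card S = l}"
  proof
    fix S assume "S \<in> copies F G"
    then show "S \<in> {S. S \<subseteq> {..<n} \<and> card S = l}"
      using G(1) copies_subset[of S F G] card_copy[of S F G] by (simp add: graphs_on_def l_def)
  qed
  then have "max_copies F n \<le> card {S. S \<subseteq> {..<n} \<and> card S = l}"
    unfolding G(2)[symmetric] by (intro card_mono) (auto intro: finite_subset[of _ "Pow {..<n}"])
  then have "max_copies F n \<le> n choose l" by (simp add: n_subsets)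
  then have "max_copies F n * fact l \<le> n ^ l"
    using binomial_fact_pow[of n l] by (meson mult_le_mono1 order_trans)
  then have "real (max_copies F n * fact l) \<le> real (n ^ l)" by (rule of_nat_mono)
  then have "fact l * real (max_copies F n) \<le> real n ^ l"
    by (simp add: mult.commute)
  then show ?thesis
    unfolding copy_density_def l_def[symmetric] divide_le_eq_1 using zero_le_power[of "real n" l] by linarith
qed

lemma copy_density_eq_ind_poly:
  assumes "n \<ge> 1"
  shows "\<exists>G\<in>graphs_on n. copy_density F n = ind_poly F G (\<lambda>_. 1 / real n)"
proof -
  obtain G where "G \<in> graphs_on n" "card (copies F G) = max_copies F n"
    using max_copies_attained by blast
  then show ?thesis
    by (intro bexI[of _ G]) (simp_all add: ind_poly_const copy_density_def power_one_over)
qed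

text \<open>Each single density is a value on the simplex, hence an asymptotic lower bound for all later
  densities; the densities therefore converge to their supremum.\<close>

lemma copy_density_tendsto_Sup:
  "copy_density F \<longlonglongrightarrow> (SUP n\<in>{1..}. copy_density F n)"
proof (rule order_tendstoI)
  have bdd: "bdd_above (copy_density F ` {1..})"
    by (rule bdd_aboveI2[of _ _ 1]) (rule copy_density_le_1)
  fix a
  {
    assume "a < (SUP n\<in>{1..}. copy_density F n)"
    then obtain n where n: "n \<ge> 1" "a < copy_density F n"
      using less_cSUP_iff[OF _ bdd] by auto
    obtain G where G: "G \<in> graphs_on n" "copy_density F n = ind_poly F G (\<lambda>_. 1 / real n)"
      using copy_density_eq_ind_poly[OF n(1)] by blast
    show "\<forall>\<^sub>F N in sequentially. a < copy_density F N"
      using G n by (intro eventually_copy_density_gt[of G "\<lambda>_. 1 / real n"]) (auto simp: graphs_on_def)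
  next
    assume a: "(SUP n\<in>{1..}. copy_density F n) < a"
    show "\<forall>\<^sub>F N in sequentially. copy_density F N < a"
      using eventually_ge_at_top[of 1]
      by eventually_elim (use cSUP_upper[OF _ bdd] a in \<open>auto intro: le_less_trans\<close>)
  }
qed

lemma tendsto_binomial_ratio:
  "(\<lambda>n. fact l * real (n choose l) / real n ^ l) \<longlonglongrightarrow> 1"
proof -
  have "(\<lambda>n. (real n - real i) / real n) \<longlonglongrightarrow> 1" for i
  proof (rule Lim_transform_eventually)
    show "(\<lambda>n. 1 - real i / real n) \<longlonglongrightarrow> 1"
      using tendsto_diff[OF tendsto_const lim_const_over_n[of "real i"], of 1] by simp
    show "\<forall>\<^sub>F n in sequentially. 1 - real i / real n = (real n - real i) / real n"
      using eventually_gt_at_top[of 0] by eventually_elim (simp add: field_simps)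
  qed
  then have "(\<lambda>n. \<Prod>i=0..<l. (real n - real i) / real n) \<longlonglongrightarrow> (\<Prod>i=0..<l. 1)"
    by (intro tendsto_prod)
  moreover have "(\<Prod>i=0..<l. (real n - real i) / real n) = fact l * real (n choose l) / real n ^ l" for n
    unfolding prod_dividef binomial_gbinomial gbinomial_prod_rev by simp
  ultimately show ?thesis by simp
qed

lemma copy_density_tendsto_inducibility: "copy_density F \<longlonglongrightarrow> inducibility F"
proof -
  define s where "s = (SUP n\<in>{1..}. copy_density F n)"
  define l where "l = card (verts F)"
  have "(\<lambda>n. copy_density F n / (fact l * real (n choose l) / real n ^ l)) \<longlonglongrightarrow> s / 1"
    unfolding s_def by (intro tendsto_divide copy_density_tendsto_Sup tendsto_binomial_ratio) simp
  moreover have "\<forall>\<^sub>F n in sequentially. copy_density F n / (fact l * real (n choose l) / real n ^ l) =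
      real (max_copies F n) / real (n choose l)"
    using eventually_gt_at_top[of 0]
    by eventually_elim (simp add: copy_density_def l_def)
  ultimately have "(\<lambda>n. real (max_copies F n) / real (n choose l)) \<longlonglongrightarrow> s"
    using Lim_transform_eventually by fastforce
  then have "inducibility F = s"
    unfolding inducibility_def l_def by (rule limI)
  then show ?thesis using copy_density_tendsto_Sup by (simp add: s_def)
qed

lemma ind_poly_le_inducibility:
  assumes "simple_graph G" "\<And>i. i \<in> verts G \<Longrightarrow> x i \<ge> 0" "(\<Sum>i\<in>verts G. x i) = 1"
  shows "ind_poly F G x \<le> inducibility F"
proof (rule ccontr)
  assume "\<not> ind_poly F G x \<le> inducibility F"
  then obtain a where a: "inducibility F < a" "a < ind_poly F G x" using dense not_le by blast
  have "\<forall>\<^sub>F n in sequentially. a < copy_density F n \<and> copy_density F n < a"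
    by (intro eventually_conj eventually_copy_density_gt[OF assms a(2)]
        order_tendstoD(2)[OF copy_density_tendsto_inducibility a(1)])
  then have "\<forall>\<^sub>F n :: nat in sequentially. False" by eventually_elim (meson less_asym)
  then show False by simp
qed

lemma inducibility_nonneg: "inducibility F \<ge> 0"
  using copy_density_tendsto_inducibility
  by (rule LIMSEQ_le_const) (auto simp: copy_density_def)

section \<open>Asymptotics of the spectral radius\<close>

text \<open>The constant vector with entries \<open>n powr (- 1 / \<alpha>)\<close> on a graph with the most copies.\<close>

lemma spec_ind_ge:
  assumes n: "n \<ge> 1" and \<alpha>: "\<alpha> > 0"
  shows "copy_density F n * real n powr (real (card (verts F)) * (1 - 1 / \<alpha>)) \<le> spec_ind \<alpha> F n"
proof -
  define l where "l = card (verts F)"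
  obtain G where G: "G \<in> graphs_on n" "card (copies F G) = max_copies F n"
    using max_copies_attained by blast
  have sG: "simple_graph G" "verts G = {..<n}" "verts G \<noteq> {}"
    using G(1) n by (auto simp: graphs_on_def lessThan_empty_iff)
  have "copy_density F n * real n powr (real l * (1 - 1 / \<alpha>)) =
      fact l * real (max_copies F n) * (real n powr (real l * (1 - 1 / \<alpha>)) / real n powr real l)"
    using n by (simp add: copy_density_def l_def powr_realpow)
  also have "real n powr (real l * (1 - 1 / \<alpha>)) / real n powr real l = (real n powr (- 1 / \<alpha>)) ^ l"
    using n by (simp add: powr_diff[symmetric] powr_realpow[symmetric] powr_powr algebra_simps)
  also have "fact l * real (max_copies F n) * (real n powr (- 1 / \<alpha>)) ^ l =
      ind_poly F G (\<lambda>_. real (card (verts G)) powr (- 1 / \<alpha>))"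
    unfolding ind_poly_const G(2) l_def sG(2) by simp
  also have "\<dots> \<le> lam_ind \<alpha> F G"
    using uniform_sphere[OF sG(1,3) \<alpha>] by (intro lam_ind_attained(2) sG \<alpha>)
  also have "\<dots> \<le> spec_ind \<alpha> F n" using G(1) by (rule lam_ind_le_spec_ind)
  finally show ?thesis by (simp add: l_def)
qed

text \<open>The polynomial is homogeneous of degree \<open>l\<close>, so rescaling an optimal vector of sum \<open>s\<close> to the
  simplex costs a factor \<open>s ^ l\<close>, and \<open>s \<le> n powr (1 - 1 / \<alpha>)\<close> by the power mean inequality.\<close>

lemma lam_ind_le:
  assumes G: "simple_graph G" "verts G \<noteq> {}" and \<alpha>: "\<alpha> \<ge> 1"
  shows "lam_ind \<alpha> F G \<le>
    inducibility F * real (card (verts G)) powr (real (card (verts F)) * (1 - 1 / \<alpha>))"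
proof -
  define l where "l = card (verts F)"
  define n where "n = real (card (verts G))"
  have fin: "finite (verts G)" using G by (simp add: simple_graph_def)
  then have n: "n > 0" using G by (simp add: n_def card_gt_0_iff)
  obtain x where x: "x \<in> ext_sphere \<alpha> (verts G)" "ind_poly F G x = lam_ind \<alpha> F G"
    using lam_ind_attained(1)[OF G, of \<alpha> F] \<alpha> by auto
  have x0: "x i \<ge> 0" if "i \<in> verts G" for i using x(1) that by (simp add: ext_sphere_def)
  have norm: "(\<Sum>i\<in>verts G. x i powr \<alpha>) = 1"
    using subsetD[OF ext_sphere_subset x(1)] by (simp add: nonneg_sphere_def)
  define s where "s = (\<Sum>i\<in>verts G. x i)"
  have "s \<noteq> 0"
  proof
    assume "s = 0"
    then have "\<forall>i\<in>verts G. x i = 0"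
      unfolding s_def using sum_nonneg_eq_0_iff[of _ x] fin x0 by blast
    then show False using norm by simp
  qed
  moreover have "s \<ge> 0" unfolding s_def using x0 by (rule sum_nonneg)
  ultimately have s: "s > 0" by simp
  have "s / n \<le> (1 / n) powr (1 / \<alpha>)"
    using power_mean_le[of "verts G" x \<alpha>] fin G(2) x0 \<alpha> norm by (simp add: s_def n_def)
  then have "s \<le> n * (1 / n) powr (1 / \<alpha>)"
    using n by (simp add: field_simps)
  also have "\<dots> = n powr (1 - 1 / \<alpha>)"
    using n by (simp add: powr_diff powr_divide)
  finally have s_le: "s \<le> n powr (1 - 1 / \<alpha>)" .
  have "lam_ind \<alpha> F G = ind_poly F G (\<lambda>i. s * (x i / s))"
    using x(2) s by simp
  also have "\<dots> = s ^ l * ind_poly F G (\<lambda>i. x i / s)"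
    unfolding l_def by (rule ind_poly_scale)
  also have "\<dots> \<le> s ^ l * inducibility F"
    using s x0 by (intro mult_left_mono ind_poly_le_inducibility G)
      (auto simp: sum_divide_distrib[symmetric] s_def[symmetric])
  also have "\<dots> \<le> (n powr (1 - 1 / \<alpha>)) ^ l * inducibility F"
    using s s_le by (intro mult_right_mono power_mono inducibility_nonneg) auto
  also have "(n powr (1 - 1 / \<alpha>)) ^ l = n powr (real l * (1 - 1 / \<alpha>))"
    using n by (simp add: powr_realpow[symmetric] powr_powr mult.commute)
  finally show ?thesis by (simp add: l_def n_def mult.commute)
qed

lemma spec_ind_le:
  assumes n: "n \<ge> 1" and \<alpha>: "\<alpha> \<ge> 1"
  shows "spec_ind \<alpha> F n \<le> inducibility F * real n powr (real (card (verts F)) * (1 - 1 / \<alpha>))"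
proof -
  have "lam_ind \<alpha> F G \<le> inducibility F * real n powr (real (card (verts F)) * (1 - 1 / \<alpha>))"
    if "G \<in> graphs_on n" for G
    using lam_ind_le[of G \<alpha> F] that n \<alpha> by (auto simp: graphs_on_def lessThan_empty_iff)
  then show ?thesis
    unfolding spec_ind_def using finite_graphs_on graphs_on_nonempty by (intro Max.boundedI) auto
qed

theorem spec_ind_asymptotics:
  assumes \<alpha>: "\<alpha> \<ge> 1"
  shows "\<exists>\<epsilon> :: nat \<Rightarrow> real. \<epsilon> \<in> o(\<lambda>n. 1) \<and> (\<forall>n\<ge>1. spec_ind \<alpha> F n =
    (inducibility F + \<epsilon> n) * real n powr (real (card (verts F)) * (1 - 1 / \<alpha>)))"
proof -
  define D where "D = (\<lambda>n. real n powr (real (card (verts F)) * (1 - 1 / \<alpha>)))"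
  have D: "D n > 0" if "n \<ge> 1" for n using that by (simp add: D_def)
  define \<epsilon> where "\<epsilon> = (\<lambda>n. spec_ind \<alpha> F n / D n - inducibility F)"
  have "\<epsilon> \<longlonglongrightarrow> 0"
  proof (rule tendsto_sandwich)
    show "\<forall>\<^sub>F n in sequentially. copy_density F n - inducibility F \<le> \<epsilon> n"
      using eventually_ge_at_top[of 1]
    proof eventually_elim
      case (elim n)
      have "copy_density F n * D n \<le> spec_ind \<alpha> F n"
        unfolding D_def using elim \<alpha> by (intro spec_ind_ge) auto
      then show ?case using D[OF elim] by (simp add: \<epsilon>_def pos_le_divide_eq)
    qed
    show "\<forall>\<^sub>F n in sequentially. \<epsilon> n \<le> 0"
      using eventually_ge_at_top[of 1]
    proof eventually_elim
      case (elim n)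
      have "spec_ind \<alpha> F n \<le> inducibility F * D n"
        unfolding D_def using elim \<alpha> by (rule spec_ind_le)
      then show ?case using D[OF elim] by (simp add: \<epsilon>_def pos_divide_le_eq)
    qed
    show "(\<lambda>n. copy_density F n - inducibility F) \<longlonglongrightarrow> 0"
      using tendsto_diff[OF copy_density_tendsto_inducibility[of F] tendsto_const[of "inducibility F"]] by simp
  qed simp
  then have "\<epsilon> \<in> o(\<lambda>n. 1)" by (intro smalloI_tendsto) auto
  moreover have "spec_ind \<alpha> F n = (inducibility F + \<epsilon> n) * D n" if "n \<ge> 1" for n
    using D[OF that] by (simp add: \<epsilon>_def)
  ultimately show ?thesis unfolding D_def by blast
qed

section \<open>Extremal graphs, optimal vectors and asymptotics\<close>

theorem theorem1p2:
  fixes F :: "'a ugraph" and l :: nat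
  assumes "complete_multipartite F" and "card (verts F) = l"
  shows
    "(\<forall>n\<ge>1. \<forall>\<alpha>\<ge>1. \<exists>G\<in>graphs_on n.
        complete_multipartite G \<and> lam_ind \<alpha> F G = spec_ind \<alpha> F n)
     \<and> (\<forall>n\<ge>1. \<forall>\<alpha>\<ge>1. \<forall>(G :: 'v ugraph) P.
        simple_graph G \<and> card (verts G) = n \<and> multipartition G P \<and>
        lam_ind \<alpha> F G = spec_ind \<alpha> F n \<longrightarrow>
        (\<exists>x\<in>OPT \<alpha> F G. \<forall>A\<in>P. \<forall>u\<in>A. \<forall>v\<in>A. x u = x v))
     \<and> (\<forall>\<alpha>\<ge>1. \<exists>\<epsilon> :: nat \<Rightarrow> real. \<epsilon> \<in> o(\<lambda>n. 1) \<and>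
        (\<forall>n\<ge>1. spec_ind \<alpha> F n =
          (inducibility F + \<epsilon> n) * real n powr (real l * (1 - 1 / \<alpha>))))"
proof (intro conjI allI impI)
  have F: "nonadj_trans F"
    using assms(1) multipartition_imp_nonadj_trans unfolding complete_multipartite_def by blast
  show "\<exists>G\<in>graphs_on n. complete_multipartite G \<and> lam_ind \<alpha> F G = spec_ind \<alpha> F n"
    if "n \<ge> 1" "\<alpha> \<ge> 1" for n \<alpha>
    using exists_multipartite_extremal[OF F that(1)] that(2) by simp
  show "\<exists>x\<in>OPT \<alpha> F G. \<forall>A\<in>P. \<forall>u\<in>A. \<forall>v\<in>A. x u = x v"
    if "n \<ge> 1" "\<alpha> \<ge> 1" "simple_graph G \<and> card (verts G) = n \<and> multipartition G P \<and>
      lam_ind \<alpha> F G = spec_ind \<alpha> F n" for n \<alpha> and G :: "'v ugraph" and P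
    using that by (intro exists_optimum_constant_on_parts) auto
  show "\<exists>\<epsilon> :: nat \<Rightarrow> real. \<epsilon> \<in> o(\<lambda>n. 1) \<and> (\<forall>n\<ge>1. spec_ind \<alpha> F n =
      (inducibility F + \<epsilon> n) * real n powr (real l * (1 - 1 / \<alpha>)))"
    if "\<alpha> \<ge> 1" for \<alpha>
    using spec_ind_asymptotics[OF that, of F] assms(2) by simp
qed

end
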